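(* Let $a<b$, $\Omega:=(a,b)$, $1<p<\infty$, $p':=p/(p-1)$, $\gamma>0$, and let $m\in L^{p'}(\Omega)$ (possibly sign-changing). Suppose the problem $$-\left(|u'|^{p-2}u'\right)'=m(x)u^{-\gamma}\ \text{ in }\Omega,\qquad u>0\ \text{ in }\Omega,\qquad u=0\ \text{ on }\partial\Omega$$ has a solution $u\in C^1(\overline\Omega)$ such that $\varphi_p(u')$ is absolutely continuous. Then $$\mathcal{S}(m)>0\ \text{ in }\Omega\qquad\text{and}\qquad \int_a^b m>0 .$$
   Context: $\varphi_p(t):=|t|^{p-2}t$ for $t\neq0$ and $\varphi_p(0):=0$. For $h\in L^q(\Omega)$ with $q>1$, $\mathcal{S}(h)$ denotes the unique $v\in C^1(\overline\Omega)$ such that $|v'|^{p-2}v'$ is absolutely continuous, $-(|v'|^{p-2}v')'=h$ a.e. in $\Omega$, and $v(a)=v(b)=0$. A solution of the singular problem is a function $u\in C^1(\Omega)\cap C(\overline\Omega)$ with $u>0$ in $\Omega$, $u=0$ on $\partial\Omega$, satisfying the equation in the sense of distributions: $\int_a^b|u'|^{p-2}u'\phi'=\int_a^b m\,u^{-\gamma}\phi$ for all $\phi\in C_c^\infty(\Omega)$. *)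

theory Defs
  imports "HOL-Analysis.Analysis"
begin

definition phi :: "real \<Rightarrow> real \<Rightarrow> real" where
  "phi p t = (if t = 0 then 0 else \<bar>t\<bar> powr (p - 2) * t)"

(* Elements of L^q(a,b) are represented by functions on the whole line of which only the
   values on (a,b) matter. *)
definition in_Lq :: "real \<Rightarrow> real \<Rightarrow> real \<Rightarrow> (real \<Rightarrow> real) \<Rightarrow> bool" where
  "in_Lq q a b h \<longleftrightarrow>
     h \<in> borel_measurable (lebesgue_on {a<..<b}) \<and>
     integrable (lebesgue_on {a<..<b}) (\<lambda>x. \<bar>h x\<bar> powr q)"

(* The usual epsilon-delta definition, over finite families of non-overlapping subintervals. *)
definition abs_continuous_on :: "real \<Rightarrow> real \<Rightarrow> (real \<Rightarrow> real) \<Rightarrow> bool" where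
  "abs_continuous_on a b f \<longleftrightarrow>
     (\<forall>\<epsilon>>0. \<exists>\<delta>>0. \<forall>(n::nat) (s::nat \<Rightarrow> real) t.
        (\<forall>i<n. a \<le> s i \<and> s i \<le> t i \<and> t i \<le> b) \<and>
        disjoint_family_on (\<lambda>i. {s i<..<t i}) {..<n} \<and>
        (\<Sum>i<n. t i - s i) < \<delta> \<longrightarrow>
        (\<Sum>i<n. \<bar>f (t i) - f (s i)\<bar>) < \<epsilon>)"

(* The derivative relative to [a,b]: one-sided at the endpoints (for a < b), hence independent
   of the values of v outside [a,b]. *)
definition deriv_on :: "real \<Rightarrow> real \<Rightarrow> (real \<Rightarrow> real) \<Rightarrow> real \<Rightarrow> real" where
  "deriv_on a b v x = vector_derivative v (at x within {a..b})"

definition C1_closed :: "real \<Rightarrow> real \<Rightarrow> (real \<Rightarrow> real) \<Rightarrow> bool" where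
  "C1_closed a b v \<longleftrightarrow>
     v differentiable_on {a..b} \<and> continuous_on {a..b} (deriv_on a b v)"

definition p_dirichlet_solution ::
    "real \<Rightarrow> real \<Rightarrow> real \<Rightarrow> (real \<Rightarrow> real) \<Rightarrow> (real \<Rightarrow> real) \<Rightarrow> bool" where
  "p_dirichlet_solution a b p h v \<longleftrightarrow>
     C1_closed a b v \<and>
     abs_continuous_on a b (\<lambda>x. phi p (deriv_on a b v x)) \<and>
     (AE x in lebesgue_on {a<..<b}.
        ((\<lambda>y. phi p (deriv_on a b v y)) has_real_derivative - h x) (at x)) \<and>
     v a = 0 \<and> v b = 0"

(* The solution operator. A function on [a,b] is represented by its extension by 0 to the
   whole line, which makes the solution unique as a HOL function. The description is
   meaningful for 1 < p and h in L^q(a,b) with q > 1. *)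
definition solution_op :: "real \<Rightarrow> real \<Rightarrow> real \<Rightarrow> (real \<Rightarrow> real) \<Rightarrow> real \<Rightarrow> real" where
  "solution_op a b p h =
     (THE v. p_dirichlet_solution a b p h v \<and> (\<forall>x. x \<notin> {a..b} \<longrightarrow> v x = 0))"

definition test_function :: "real \<Rightarrow> real \<Rightarrow> (real \<Rightarrow> real) \<Rightarrow> bool" where
  "test_function a b \<psi> \<longleftrightarrow>
     (\<forall>n x. (deriv ^^ n) \<psi> field_differentiable (at x)) \<and>
     compact (closure {x. \<psi> x \<noteq> 0}) \<and> closure {x. \<psi> x \<noteq> 0} \<subseteq> {a<..<b}"

definition singular_solution ::
    "real \<Rightarrow> real \<Rightarrow> real \<Rightarrow> real \<Rightarrow> (real \<Rightarrow> real) \<Rightarrow> (real \<Rightarrow> real) \<Rightarrow> bool" where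
  "singular_solution a b p \<gamma> m u \<longleftrightarrow>
     u C1_differentiable_on {a<..<b} \<and> continuous_on {a..b} u \<and>
     (\<forall>x\<in>{a<..<b}. 0 < u x) \<and> u a = 0 \<and> u b = 0 \<and>
     (\<forall>\<psi>. test_function a b \<psi> \<longrightarrow>
        (LINT x|lebesgue_on {a<..<b}. phi p (deriv u x) * deriv \<psi> x) =
        (LINT x|lebesgue_on {a<..<b}. m x * u x powr (- \<gamma>) * \<psi> x))"

end

theory Submission
  imports Defs
begin

text \<open>
  Write \<open>w = \<phi>\<^sub>p(u')\<close>, let \<open>M\<close> be the primitive of \<open>m\<close> vanishing at \<open>a\<close>, and put
  \<open>K = M + u\<^sup>\<gamma> w\<close>. Testing the equation with smoothed indicators of intervals gives
  \<open>w(y) - w(x) = - \<integral> m u\<^sup>-\<^sup>\<gamma>\<close> over \<open>[x, y]\<close>, so \<open>K\<close> is differentiable in \<open>(a, b)\<close> with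
  \<open>K' = (u\<^sup>\<gamma>)' w = \<gamma> u\<^sup>\<gamma>\<^sup>-\<^sup>1 \<bar>u'\<bar>\<^sup>p \<ge> 0\<close>. Since \<open>K(a) = 0\<close> and \<open>K(b) = \<integral> m\<close>, the integral of \<open>m\<close> is
  nonnegative, and it vanishes only if \<open>u\<close> is constant.

  For \<open>v = S(m)\<close> one has \<open>\<phi>\<^sub>p(v') = c - M\<close>, while \<open>U = u\<^sup>1\<^sup>+\<^sup>k / (1 + k)\<close> with \<open>k = \<gamma> / (p - 1)\<close>
  satisfies \<open>\<phi>\<^sub>p(U') = u\<^sup>\<gamma> w\<close>. Hence \<open>\<phi>\<^sub>p(v') - \<phi>\<^sub>p(U') = c - K\<close> is nonincreasing; as \<open>v\<close> and \<open>U\<close> agree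
  at both endpoints, the mean value theorem forces \<open>v \<ge> U > 0\<close>.
\<close>

subsection \<open>Smooth step functions and weak derivatives\<close>

text \<open>The regularity clause of \<open>test_function\<close>, separated from the support
  condition.\<close>

definition smooth :: "(real \<Rightarrow> real) \<Rightarrow> bool" where
  "smooth f \<longleftrightarrow> (\<forall>n x. (deriv ^^ n) f field_differentiable at x)"

text \<open>Every iterated derivative of a member of \<open>S\<close> stays in \<open>S\<close>, so
  a class closed under differentiation consists of smooth functions and no higher derivative has to
  be computed.\<close>

lemma smooth_coinduct:
  assumes "f \<in> S"
    and step: "\<And>f. f \<in> S \<Longrightarrow> \<exists>g\<in>S. \<forall>x. (f has_field_derivative g x) (at x)"
  shows "smooth f"
proof -
  have "(deriv ^^ n) f \<in> S" for n
  proof (induction n)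
    case (Suc n)
    then obtain g where g: "g \<in> S" "\<And>x. ((deriv ^^ n) f has_field_derivative g x) (at x)"
      using step by blast
    then have "deriv ((deriv ^^ n) f) = g"
      by (auto simp: fun_eq_iff intro: DERIV_imp_deriv)
    with g show ?case by simp
  qed (use assms in simp)
  then show ?thesis
    unfolding smooth_def using step field_differentiable_def by metis
qed

text \<open>The classical flat function exp(-1/t), extended by 0 to the left and multiplied by a
  polynomial in 1/t. The polynomial factor makes the family closed under differentiation; exp(-1/t)
  itself is \<open>flat 1\<close>.\<close>

definition flat :: "real poly \<Rightarrow> real \<Rightarrow> real" where
  "flat P t = (if t \<le> 0 then 0 else poly P (inverse t) * exp (- inverse t))"

lemma poly_div_exp_tendsto_0:
  fixes P :: "real poly"
  shows "((\<lambda>x. poly P x * exp (- x)) \<longlongrightarrow> 0) at_top"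
proof -
  have "((\<lambda>x. \<Sum>i\<le>degree P. coeff P i * (x ^ i / exp x)) \<longlongrightarrow> (\<Sum>i\<le>degree P. coeff P i * 0)) at_top"
    by (intro tendsto_intros tendsto_power_div_exp_0)
  then show ?thesis
    by (simp add: poly_altdef exp_minus divide_inverse sum_distrib_right mult.assoc)
qed

text \<open>With s = 1/t one has ds/dt = -s^2, so P(s) exp(-s) has derivative s^2 (P(s) - P'(s))
  exp(-s), again in the family. At the origin the exponential beats every polynomial.\<close>

lemma flat_has_derivative:
  "(flat P has_field_derivative flat ([:0, 0, 1:] * (P - pderiv P)) t) (at t)"
proof -
  consider "t < 0" | "t = 0" | "t > 0" by linarith
  then show ?thesis
  proof cases
    case 1
    have "(flat P has_field_derivative 0) (at t)"
      by (rule has_field_derivative_transform_within_open[of "\<lambda>_. 0" _ _ "{..<0}"])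
        (use 1 in \<open>auto simp: flat_def\<close>)
    then show ?thesis using 1 by (simp add: flat_def)
  next
    case 2
    \<comment> \<open>Dividing by h multiplies the polynomial by 1/h, so the difference quotient at
      0 from the right is once more a polynomial in 1/h times exp(-1/h).\<close>
    have lim: "((\<lambda>h. poly ([:0, 1:] * P) (inverse h) * exp (- inverse h)) \<longlongrightarrow> 0) (at_right 0)"
      using poly_div_exp_tendsto_0 filterlim_inverse_at_top_right by (rule filterlim_compose)
    have "((\<lambda>h. flat P h / h) \<longlongrightarrow> 0) (at_right 0)"
      by (rule Lim_transform_eventually[OF lim])
        (auto simp: eventually_at_right_field flat_def field_simps intro!: exI[of _ 1])
    moreover have "((\<lambda>h. flat P h / h) \<longlongrightarrow> 0) (at_left 0)"
      by (rule Lim_transform_eventually[OF tendsto_const])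
        (auto simp: eventually_at_left_field flat_def intro!: exI[of _ "-1"])
    ultimately have "((\<lambda>h. flat P h / h) \<longlongrightarrow> 0) (at 0)"
      by (simp add: filterlim_split_at)
    then show ?thesis
      using 2 by (simp add: DERIV_def flat_def)
  next
    case 3
    have "((\<lambda>t. poly P (inverse t) * exp (- inverse t)) has_field_derivative
        flat ([:0, 0, 1:] * (P - pderiv P)) t) (at t)"
      using 3 by (auto intro!: derivative_eq_intros DERIV_chain2[OF poly_DERIV]
          simp: flat_def power2_eq_square algebra_simps)
    then show ?thesis
      by (rule has_field_derivative_transform_within_open[of _ _ _ "{0<..}"])
        (use 3 in \<open>auto simp: flat_def\<close>)
  qed
qed

text \<open>Generated by exactly the operations that build the step functions and their differences.
  Closure under differentiation then gives smoothness by \<open>smooth_coinduct\<close>.\<close>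

inductive_set flat_algebra :: "(real \<Rightarrow> real) set" where
  const: "(\<lambda>x. c) \<in> flat_algebra"
| flat: "(\<lambda>x. flat P (c * x + d)) \<in> flat_algebra"
| add: "f \<in> flat_algebra \<Longrightarrow> g \<in> flat_algebra \<Longrightarrow> (\<lambda>x. f x + g x) \<in> flat_algebra"
| mult: "f \<in> flat_algebra \<Longrightarrow> g \<in> flat_algebra \<Longrightarrow> (\<lambda>x. f x * g x) \<in> flat_algebra"
| inverse: "f \<in> flat_algebra \<Longrightarrow> (\<And>x. f x \<noteq> 0) \<Longrightarrow> (\<lambda>x. inverse (f x)) \<in> flat_algebra"

lemma flat_algebra_derivative:
  assumes "f \<in> flat_algebra"
  shows "\<exists>g\<in>flat_algebra. \<forall>x. (f has_field_derivative g x) (at x)"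
  using assms
proof induction
  case (const c)
  show ?case by (rule bexI[of _ "\<lambda>x. 0"]) (auto intro: flat_algebra.const)
next
  case (flat P c d)
  have "((\<lambda>x. flat P (c * x + d)) has_field_derivative
      flat ([:0, 0, 1:] * (P - pderiv P)) (c * x + d) * c) (at x)" for x
    by (rule DERIV_chain2[OF flat_has_derivative]) (auto intro!: derivative_eq_intros)
  then show ?case
    by (intro bexI[of _ "\<lambda>x. flat ([:0, 0, 1:] * (P - pderiv P)) (c * x + d) * c"])
      (auto intro: flat_algebra.intros)
next
  case (add f g)
  then obtain f' g' where "f' \<in> flat_algebra" "g' \<in> flat_algebra"
    "\<And>x. (f has_field_derivative f' x) (at x)" "\<And>x. (g has_field_derivative g' x) (at x)"
    by blast
  then show ?case
    by (intro bexI[of _ "\<lambda>x. f' x + g' x"]) (auto intro!: flat_algebra.add DERIV_add)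
next
  case (mult f g)
  then obtain f' g' where "f' \<in> flat_algebra" "g' \<in> flat_algebra"
    "\<And>x. (f has_field_derivative f' x) (at x)" "\<And>x. (g has_field_derivative g' x) (at x)"
    by blast
  with mult show ?case
    by (intro bexI[of _ "\<lambda>x. f' x * g x + g' x * f x"])
      (auto intro!: flat_algebra.add flat_algebra.mult DERIV_mult)
next
  case (inverse f)
  then obtain f' where f': "f' \<in> flat_algebra" "\<And>x. (f has_field_derivative f' x) (at x)"
    by blast
  \<comment> \<open>The derivative -f'/f^2 is written as a product of members, with -1 as a
    constant, so that the closure rules apply to it directly.\<close>
  have "(\<lambda>x. (-1) * (inverse (f x) * f' x * inverse (f x))) \<in> flat_algebra"
    by (intro flat_algebra.mult flat_algebra.const flat_algebra.inverse inverse f')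
  moreover have "((\<lambda>x. inverse (f x)) has_field_derivative (-1) * (inverse (f x) * f' x * inverse (f x))) (at x)" for x
    using DERIV_inverse'[OF f'(2) inverse(2)] by simp
  ultimately show ?case by (auto intro!: bexI[of _ "\<lambda>x. (-1) * (inverse (f x) * f' x * inverse (f x))"])
qed

lemma smooth_flat_algebra: "f \<in> flat_algebra \<Longrightarrow> smooth f"
  by (rule smooth_coinduct[OF _ flat_algebra_derivative])

text \<open>The standard smooth transition from 0 on t \<le> 0 to 1 on t \<ge> 1. Its derivative is
  supported in [0, 1] and has integral 1, so rescaling it yields an approximate identity.\<close>

definition step :: "real \<Rightarrow> real" where
  "step t = flat 1 t * inverse (flat 1 t + flat 1 (1 - t))"

lemma flat_1: "flat 1 t \<ge> 0" "flat 1 t > 0 \<longleftrightarrow> t > 0" "flat 1 t = 0 \<longleftrightarrow> t \<le> 0"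
  by (auto simp: flat_def)

lemma step_denominator_pos: "flat 1 t + flat 1 (1 - t) > 0"
  using flat_1(1)[of t] flat_1(1)[of "1 - t"] flat_1(2)[of t] flat_1(2)[of "1 - t"]
  by (cases "t > 0") (auto intro: add_pos_nonneg add_nonneg_pos)

lemma step_affine: "(\<lambda>x. step (c * x + d)) \<in> flat_algebra"
proof -
  \<comment> \<open>The argument 1 - (c x + d) is put into affine form, as the generator
    \<open>flat\<close> of the algebra demands.\<close>
  have "(\<lambda>x. flat 1 (c * x + d) * inverse (flat 1 (c * x + d) + flat 1 ((- c) * x + (1 - d)))) \<in> flat_algebra"
    using step_denominator_pos[of "c * x + d" for x]
    by (intro flat_algebra.intros) (simp add: algebra_simps order_less_imp_not_eq2)
  then show ?thesis by (simp add: step_def algebra_simps)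
qed

lemma step_bounds: "0 \<le> step t" "step t \<le> 1"
  using flat_1(1)[of t] flat_1(1)[of "1 - t"] step_denominator_pos[of t]
  by (simp_all add: step_def field_simps)

lemma step_eq_0: "t \<le> 0 \<Longrightarrow> step t = 0"
  by (simp add: step_def flat_1)

lemma step_eq_1: "t \<ge> 1 \<Longrightarrow> step t = 1"
  using flat_1[of t] flat_1(3)[of "1 - t"] by (auto simp: step_def)

lemma step_has_derivative: "(step has_field_derivative deriv step t) (at t)"
  and continuous_on_deriv_step: "continuous_on S (deriv step)"
proof -
  have "smooth step"
    using smooth_flat_algebra[OF step_affine[of 1 0]] by simp
  then have 1: "(deriv ^^ n) step field_differentiable at x" for n x
    by (simp add: smooth_def)
  show "(step has_field_derivative deriv step t) (at t)"
    using 1[of 0] by (simp add: DERIV_deriv_iff_field_differentiable)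
  show "continuous_on S (deriv step)"
    using 1[of 1] by (auto intro!: continuous_at_imp_continuous_on field_differentiable_imp_continuous_at)
qed

lemma deriv_step_eq_0:
  assumes "t \<notin> {0..1}"
  shows "deriv step t = 0"
proof -
  consider "t < 0" | "t > 1" using assms by fastforce
  then show ?thesis
  proof cases
    case 1
    have "(step has_field_derivative 0) (at t)"
      by (rule has_field_derivative_transform_within_open[of "\<lambda>_. 0" _ _ "{..<0}"])
        (use 1 in \<open>auto simp: step_eq_0\<close>)
    then show ?thesis by (rule DERIV_imp_deriv)
  next
    case 2
    have "(step has_field_derivative 0) (at t)"
      by (rule has_field_derivative_transform_within_open[of "\<lambda>_. 1" _ _ "{1<..}"])
        (use 2 in \<open>auto simp: step_eq_1\<close>)
    then show ?thesis by (rule DERIV_imp_deriv)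
  qed
qed

lemma deriv_step_bounded:
  obtains B where "B > 0" "\<And>t. \<bar>deriv step t\<bar> \<le> B"
proof -
  have "bounded (deriv step ` {0..1})"
    by (intro compact_imp_bounded compact_continuous_image continuous_on_deriv_step compact_Icc)
  then obtain B where "B > 0" "\<And>t. t \<in> {0..1} \<Longrightarrow> \<bar>deriv step t\<bar> \<le> B"
    by (auto simp: bounded_pos)
  then show ?thesis
    using that deriv_step_eq_0 by (metis abs_zero less_le_not_le linorder_not_le)
qed

lemma deriv_step_scaled:
  "((\<lambda>t. step (c * (t - x))) has_field_derivative c * deriv step (c * (t - x))) (at t within S)"
proof -
  have "((\<lambda>t. step (c * (t - x))) has_field_derivative deriv step (c * (t - x)) * c) (at t)"
    by (rule DERIV_chain2[OF step_has_derivative]) (auto intro!: derivative_eq_intros)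
  then show ?thesis by (simp add: mult.commute has_field_derivative_at_within)
qed

section \<open>Approximate identities and the integrated form of a weak equation\<close>

text \<open>The kernel n step'(n (t - x)) has mass 1 and lives on [x, x + 1/n], to the right of x;
  hence x may equal a but must stay below b. It is bounded by n B on an interval of length 1/n, so
  the error is at most B times the oscillation of \<open>w\<close> there.\<close>

lemma approximate_delta:
  fixes w :: "real \<Rightarrow> real"
  assumes w: "continuous_on {a..b} w" and x: "a \<le> x" "x < b"
  shows "(\<lambda>n. integral {a..b} (\<lambda>t. w t * (real n * deriv step (real n * (t - x))))) \<longlonglongrightarrow> w x"
proof (rule LIMSEQ_I)
  fix e :: real assume "0 < e"
  obtain B where B: "B > 0" "\<And>t. \<bar>deriv step t\<bar> \<le> B"
    using deriv_step_bounded by blast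
  \<comment> \<open>The factor 1 / (2 B) compensates for the bound n B of the kernel on its support
    of length 1/n, leaving a total error of e/2.\<close>
  obtain d where d: "d > 0" "\<And>t. t \<in> {a..b} \<Longrightarrow> \<bar>t - x\<bar> < d \<Longrightarrow> \<bar>w t - w x\<bar> < e / (2 * B)"
    using w[unfolded continuous_on_iff, rule_format, of x "e / (2 * B)"] x B \<open>0 < e\<close>
    by (auto simp: dist_real_def)
  \<comment> \<open>From this index on, the support [x, x + 1/n] fits both into the d-neighbourhood
    of x and into [a, b].\<close>
  obtain N :: nat where N: "1 / min d (b - x) < real N" using reals_Archimedean2 by blast
  have pos: "min d (b - x) > 0" using d x by simp
  have "norm (integral {a..b} (\<lambda>t. w t * (real n * deriv step (real n * (t - x)))) - w x) < e"
    if "n \<ge> N" for n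
  proof -
    let ?D = "\<lambda>t. real n * deriv step (real n * (t - x))"
    have n: "1 / min d (b - x) < real n" using N that by linarith
    then have n0: "n > 0" using pos by (smt (verit) divide_pos_pos of_nat_0_less_iff)
    have n1: "1 / real n < min d (b - x)"
    proof -
      have "1 < min d (b - x) * real n"
        using n pos by (simp only: pos_divide_less_eq mult.commute)
      then show ?thesis using n0 by (simp only: pos_divide_less_eq of_nat_0_less_iff)
    qed
    have cD: "continuous_on S ?D" for S
      by (intro continuous_intros continuous_on_compose2[OF continuous_on_deriv_step[of UNIV]]) auto
    have "(?D has_integral step (real n * (b - x)) - step (real n * (a - x))) {a..b}"
      by (rule fundamental_theorem_of_calculus)
        (use x in \<open>auto intro!: deriv_step_scaled simp: has_real_derivative_iff_has_vector_derivative[symmetric]\<close>)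
    moreover have "step (real n * (b - x)) = 1"
      using n1 n0 by (intro step_eq_1) (simp add: field_simps)
    moreover have "step (real n * (a - x)) = 0"
      using x by (intro step_eq_0) (simp add: mult_nonneg_nonpos)
    ultimately have I1: "(?D has_integral 1) {a..b}" by simp
    \<comment> \<open>Since the kernel has mass 1, the number \<open>w x\<close> can be moved under
      the integral.\<close>
    have "integral {a..b} (\<lambda>t. w t * ?D t) - w x = integral {a..b} (\<lambda>t. w t * ?D t) - integral {a..b} (\<lambda>t. w x * ?D t)"
      by (simp only: integral_unique[OF has_integral_mult_right[OF I1, of "w x"]] mult_1_right)
    also have "\<dots> = integral {a..b} (\<lambda>t. (w t - w x) * ?D t)"
      unfolding left_diff_distrib
      by (intro integral_diff[symmetric] integrable_continuous_interval continuous_intros w cD)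
    also have "\<dots> = integral {x..x + 1 / real n} (\<lambda>t. (w t - w x) * ?D t)"
    proof -
      have "(w t - w x) * ?D t = (if t \<in> {x..x + 1 / real n} then (w t - w x) * ?D t else 0)" for t
        using n0 by (auto intro!: deriv_step_eq_0 simp: field_simps zero_le_mult_iff)
      then have "integral {a..b} (\<lambda>t. (w t - w x) * ?D t) =
          integral {a..b} (\<lambda>t. if t \<in> {x..x + 1 / real n} then (w t - w x) * ?D t else 0)"
        by (rule Henstock_Kurzweil_Integration.integral_cong)
      also have "\<dots> = integral ({x..x + 1 / real n} \<inter> {a..b}) (\<lambda>t. (w t - w x) * ?D t)"
        by (rule Henstock_Kurzweil_Integration.integral_restrict_Int)
      also have "{x..x + 1 / real n} \<inter> {a..b} = {x..x + 1 / real n}" using n1 x by auto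
      finally show ?thesis .
    qed
    finally have eq: "integral {a..b} (\<lambda>t. w t * ?D t) - w x = integral {x..x + 1 / real n} (\<lambda>t. (w t - w x) * ?D t)" .
    have "norm (integral {x..x + 1 / real n} (\<lambda>t. (w t - w x) * ?D t)) \<le> (e / (2 * B) * (real n * B)) * (x + 1 / real n - x)"
    proof (rule integral_bound)
      show "continuous_on {x..x + 1 / real n} (\<lambda>t. (w t - w x) * ?D t)"
        using n1 x by (intro continuous_intros cD continuous_on_subset[OF w]) auto
      fix t assume "t \<in> {x..x + 1 / real n}"
      then have "\<bar>w t - w x\<bar> \<le> e / (2 * B)"
        using n1 x d(2)[of t] by auto
      moreover have "\<bar>?D t\<bar> \<le> real n * B"
        using B by (simp add: abs_mult mult_left_mono)
      ultimately show "norm ((w t - w x) * ?D t) \<le> e / (2 * B) * (real n * B)"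
        using \<open>0 < e\<close> B by (simp add: abs_mult[of "w t - w x"] mult_mono del: times_divide_eq_left)
    qed (use n0 in auto)
    also have "\<dots> = e / 2" using n0 B by (simp add: field_simps)
    also have "\<dots> < e" using \<open>0 < e\<close> by simp
    finally show ?thesis unfolding eq .
  qed
  then show "\<exists>N. \<forall>n\<ge>N. norm (integral {a..b} (\<lambda>t. w t * (real n * deriv step (real n * (t - x)))) - w x) < e"
    by blast
qed

text \<open>The equation is tested with a smoothed indicator of [x, y]. As the ramps steepen, the
  derivative of the test function tends to a point mass at x minus one at y, and the function itself
  to the indicator. Integrability of \<open>g\<close> is assumed only on compact subintervals,
  because the intended \<open>g\<close> may be singular at the endpoints.\<close>

lemma weak_derivative_eq_integral:
  fixes w g :: "real \<Rightarrow> real"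
  assumes w: "continuous_on {a..b} w"
    and g: "\<And>x y. a < x \<Longrightarrow> y < b \<Longrightarrow> g absolutely_integrable_on {x..y}"
    and weak: "\<And>\<psi>. test_function a b \<psi> \<Longrightarrow>
      (LINT x|lebesgue_on {a<..<b}. w x * deriv \<psi> x) = (LINT x|lebesgue_on {a<..<b}. g x * \<psi> x)"
    and xy: "a < x" "x < y" "y < b"
  shows "w y - w x = - integral {x..y} g"
proof -
  \<comment> \<open>The descending ramp of the test function occupies [y, y + 1/c]; \<open>z\<close>
    leaves room for it inside (a, b), and c \<ge> N keeps the ramp below \<open>z\<close>.\<close>
  define z where "z = (y + b) / 2"
  have z: "y < z" "z < b" using xy by (auto simp: z_def)
  obtain N :: nat where N: "1 / (z - y) < real N" using reals_Archimedean2 by blast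
  then have "N > 0" using z by (smt (verit) divide_pos_pos of_nat_0_less_iff)
  define \<psi> where "\<psi> = (\<lambda>(c::real) t. step (c * (t - x)) - step (c * (t - y)))"
  have gz: "g absolutely_integrable_on {x..z}" using g xy z by simp
  have eq: "integral {a..b} (\<lambda>t. w t * (c * deriv step (c * (t - x)))) -
      integral {a..b} (\<lambda>t. w t * (c * deriv step (c * (t - y)))) = integral {x..z} (\<lambda>t. g t * \<psi> c t)"
    and intg: "(\<lambda>t. g t * \<psi> c t) integrable_on {x..z}"
    if c: "c \<ge> real N" for c
  proof -
    have c0: "c > 0" using c \<open>N > 0\<close> by linarith
    have c1: "1 < c * (z - y)"
    proof -
      have "1 < real N * (z - y)" using N z by (simp add: field_simps)
      also have "\<dots> \<le> c * (z - y)" using c z by (intro mult_right_mono) auto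
      finally show ?thesis .
    qed
    have supp: "\<psi> c t = 0" if "t \<notin> {x..z}" for t
    proof (cases "t < x")
      case True
      then have "c * (t - x) \<le> 0" "c * (t - y) \<le> 0" using c0 xy by (auto simp: mult_le_0_iff)
      then show ?thesis by (simp add: \<psi>_def step_eq_0)
    next
      case False
      then have "t > z" using that by auto
      then have "c * (z - y) \<le> c * (t - y)" "c * (t - y) \<le> c * (t - x)"
        using c0 xy by auto
      then show ?thesis using c1 by (simp add: \<psi>_def step_eq_1)
    qed
    have "(\<lambda>t. step (c * t + (- c * x)) + (-1) * step (c * t + (- c * y))) \<in> flat_algebra"
      by (intro flat_algebra.add flat_algebra.mult flat_algebra.const step_affine)
    then have "\<psi> c \<in> flat_algebra" by (simp add: \<psi>_def algebra_simps)
    then have sm: "smooth (\<psi> c)" by (rule smooth_flat_algebra)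
    have cont: "continuous_on S (\<psi> c)" for S
      using sm[unfolded smooth_def, rule_format, of 0]
      by (auto intro!: continuous_at_imp_continuous_on field_differentiable_imp_continuous_at)
    have sub: "closure {t. \<psi> c t \<noteq> 0} \<subseteq> {x..z}"
      using supp by (intro closure_minimal closed_atLeastAtMost) blast
    have test: "test_function a b (\<psi> c)"
      unfolding test_function_def
      using sm sub xy z
      by (auto simp: smooth_def compact_eq_bounded_closed intro: bounded_subset[OF bounded_closed_interval[of x z]])
    have d: "deriv (\<psi> c) t = c * deriv step (c * (t - x)) - c * deriv step (c * (t - y))" for t
      unfolding \<psi>_def by (intro DERIV_imp_deriv DERIV_diff deriv_step_scaled)
    have cD: "continuous_on S (\<lambda>t. c * deriv step (c * (t - s)))" for S s
      by (intro continuous_intros continuous_on_compose2[OF continuous_on_deriv_step[of UNIV]]) auto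
    have "(\<lambda>t. w t * deriv (\<psi> c) t) absolutely_integrable_on {a..b}"
      unfolding d by (intro absolutely_integrable_continuous_real continuous_intros w cD)
    then have "(\<lambda>t. w t * deriv (\<psi> c) t) absolutely_integrable_on {a<..<b}"
      by (rule set_integrable_subset) auto
    then have "integrable (lebesgue_on {a<..<b}) (\<lambda>t. w t * deriv (\<psi> c) t)"
      by (intro absolutely_integrable_imp_integrable) auto
    then have "(LINT t|lebesgue_on {a<..<b}. w t * deriv (\<psi> c) t) = integral {a<..<b} (\<lambda>t. w t * deriv (\<psi> c) t)"
      by (intro lebesgue_integral_eq_integral) auto
    also have "\<dots> = integral {a..b} (\<lambda>t. w t * deriv (\<psi> c) t)"
      by (simp add: integral_open_interval_real)
    also have "\<dots> = integral {a..b} (\<lambda>t. w t * (c * deriv step (c * (t - x)))) -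
      integral {a..b} (\<lambda>t. w t * (c * deriv step (c * (t - y))))"
      unfolding d right_diff_distrib[of "w _"]
      by (intro integral_diff integrable_continuous_interval continuous_intros w cD)
    finally have L: "(LINT t|lebesgue_on {a<..<b}. w t * deriv (\<psi> c) t) = \<dots>" .
    have "(\<lambda>t. \<psi> c t * g t) absolutely_integrable_on {x..z}"
      using gz cont
      by (intro absolutely_integrable_bounded_measurable_product_real)
        (auto intro!: continuous_imp_measurable_on_sets_lebesgue compact_imp_bounded compact_continuous_image)
    then have ai: "(\<lambda>t. g t * \<psi> c t) absolutely_integrable_on {x..z}" by (simp add: mult.commute)
    then show "(\<lambda>t. g t * \<psi> c t) integrable_on {x..z}"
      by (rule set_lebesgue_integral_eq_integral)
    have "(LINT t|lebesgue_on {a<..<b}. g t * \<psi> c t) =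
        (LINT t|lebesgue_on {a<..<b}. (if t \<in> {x..z} then g t * \<psi> c t else 0))"
      using supp by (intro Bochner_Integration.integral_cong) auto
    also have "\<dots> = (LINT t|lebesgue_on {x..z}. g t * \<psi> c t)"
      using xy z by (intro Lebesgue_Measure.integral_restrict) auto
    also have "\<dots> = integral {x..z} (\<lambda>t. g t * \<psi> c t)"
      using ai by (intro lebesgue_integral_eq_integral absolutely_integrable_imp_integrable) auto
    finally show "integral {a..b} (\<lambda>t. w t * (c * deriv step (c * (t - x)))) -
      integral {a..b} (\<lambda>t. w t * (c * deriv step (c * (t - y)))) = integral {x..z} (\<lambda>t. g t * \<psi> c t)"
      using weak[OF test] L by simp
  qed
  \<comment> \<open>The index is shifted by \<open>N\<close> so that every member of the sequence is
    an admissible test function.\<close>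
  have "(\<lambda>n. integral {a..b} (\<lambda>t. w t * (real (n + N) * deriv step (real (n + N) * (t - s))))) \<longlonglongrightarrow> w s"
    if "a \<le> s" "s < b" for s
    by (rule LIMSEQ_ignore_initial_segment[OF approximate_delta[OF w that]])
  then have "(\<lambda>n. integral {a..b} (\<lambda>t. w t * (real (n + N) * deriv step (real (n + N) * (t - x)))) -
      integral {a..b} (\<lambda>t. w t * (real (n + N) * deriv step (real (n + N) * (t - y))))) \<longlonglongrightarrow> w x - w y"
    using xy by (intro tendsto_diff) auto
  then have lim1: "(\<lambda>n. integral {x..z} (\<lambda>t. g t * \<psi> (real (n + N)) t)) \<longlonglongrightarrow> w x - w y"
    by (subst (asm) eq) auto
  \<comment> \<open>Dominated convergence with majorant |g|, since the smoothed indicator is a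
    difference of two values in [0, 1]. At t = x both steps vanish, while at t = y only the second
    does, so the pointwise limit is the indicator of the half-open interval.\<close>
  have lim2: "(\<lambda>n. integral {x..z} (\<lambda>t. g t * \<psi> (real (n + N)) t)) \<longlonglongrightarrow>
      integral {x..z} (\<lambda>t. if t \<in> {x<..y} then g t else 0)"
  proof (rule dominated_convergence)
    show "(\<lambda>t. \<bar>g t\<bar>) integrable_on {x..z}"
      using gz unfolding absolutely_integrable_on_def real_norm_def by blast
    show "norm (g t * \<psi> (real (k + N)) t) \<le> \<bar>g t\<bar>" for k t
      using step_bounds[of "real (k + N) * (t - x)"] step_bounds[of "real (k + N) * (t - y)"]
      by (simp add: \<psi>_def abs_mult mult_left_le abs_le_iff)
    fix t
    have far: "\<forall>\<^sub>F k in sequentially. 1 \<le> real (k + N) * s" if "s > 0" for s :: real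
    proof -
      have "filterlim (\<lambda>k. real (k + N) * s) at_top sequentially"
        using that by (intro filterlim_at_top_mult_tendsto_pos[OF tendsto_const]
          filterlim_compose[OF filterlim_real_sequentially] filterlim_add_const_nat_at_top)
      then show ?thesis by (simp add: filterlim_at_top)
    qed
    have "\<forall>\<^sub>F k in sequentially. g t * \<psi> (real (k + N)) t = (if t \<in> {x<..y} then g t else 0)"
    proof -
      consider "t \<le> x" | "x < t" "t \<le> y" | "y < t" by linarith
      then show ?thesis
      proof cases
        case 1
        then have "real (k + N) * (t - x) \<le> 0" "real (k + N) * (t - y) \<le> 0" for k
          using xy by (auto simp: mult_le_0_iff)
        then show ?thesis using 1 by (simp add: \<psi>_def step_eq_0 del: of_nat_add)
      next
        case 2
        then have neg: "real (k + N) * (t - y) \<le> 0" for k by (auto simp: mult_le_0_iff)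
        have "\<forall>\<^sub>F k in sequentially. 1 \<le> real (k + N) * (t - x)" using 2 by (intro far) simp
        then show ?thesis
          by eventually_elim (use 2 neg in \<open>simp add: \<psi>_def step_eq_0 step_eq_1 del: of_nat_add\<close>)
      next
        case 3
        then have "\<forall>\<^sub>F k in sequentially. 1 \<le> real (k + N) * (t - x)"
          "\<forall>\<^sub>F k in sequentially. 1 \<le> real (k + N) * (t - y)" using xy by (auto intro!: far simp del: of_nat_add)
        then show ?thesis
          by eventually_elim (use 3 in \<open>simp add: \<psi>_def step_eq_1 del: of_nat_add\<close>)
      qed
    qed
    then show "(\<lambda>k. g t * \<psi> (real (k + N)) t) \<longlonglongrightarrow> (if t \<in> {x<..y} then g t else 0)"
      by (rule tendsto_eventually)
  qed (use intg in auto)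
  have "integral {x..z} (\<lambda>t. if t \<in> {x<..y} then g t else 0) = integral ({x<..y} \<inter> {x..z}) g"
    by (rule Henstock_Kurzweil_Integration.integral_restrict_Int)
  also have "{x<..y} \<inter> {x..z} = {x<..y}" using z by auto
  also have "integral {x<..y} g = integral {x..y} g"
    by (rule integral_subset_negligible) (auto intro: negligible_subset[of "{x}"])
  finally show ?thesis using LIMSEQ_unique[OF lim1 lim2] by simp
qed

subsection \<open>Absolute continuity and the Lebesgue differentiation theorem\<close>

text \<open>
  Points where the difference quotients stay \<open>1 / Suc n\<close> away from \<open>f x\<close> are covered, up to a null
  set, by disjoint intervals having such a point as an endpoint (Vitali). These form a fine tagged
  partial division violating the Henstock estimate unless their total length is small.
\<close>

lemma negligible_not_deriv_indefinite_integral: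
  fixes f :: "real \<Rightarrow> real"
  assumes f: "f integrable_on {a..b}"
  shows "negligible {x \<in> {a<..<b}. \<not> ((\<lambda>y. integral {a..y} f) has_real_derivative f x) (at x)}"
proof -
  define F where "F = (\<lambda>y. integral {a..y} f)"
  define E where "E = (\<lambda>n::nat. {x \<in> {a<..<b}. \<forall>d>0. \<exists>y. y \<noteq> x \<and> \<bar>y - x\<bar> < d \<and>
    \<bar>F y - F x - f x * (y - x)\<bar> > \<bar>y - x\<bar> / real (Suc n)})"
  have F: "F y - F x = integral {x..y} f" if "a \<le> x" "x \<le> y" "y \<le> b" for x y
    using Henstock_Kurzweil_Integration.integral_combine[of a x y f] that integrable_subinterval_real[OF f, of a y]
    by (auto simp: F_def)
  have "negligible (E n)" for n
    unfolding negligible_outer_le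
  proof (intro allI impI)
    fix \<mu> :: real assume \<mu>: "\<mu> > 0"
    \<comment> \<open>On each selected interval the Henstock error exceeds length / (n + 1), so this
      tolerance bounds the total length by \<mu>.\<close>
    define \<eta> where "\<eta> = \<mu> / real (Suc n)"
    have "\<eta> > 0" using \<mu> by (simp add: \<eta>_def)
    then obtain \<gamma> where \<gamma>: "gauge \<gamma>" and henstock: "\<And>p. p tagged_partial_division_of cbox a b \<Longrightarrow> \<gamma> fine p \<Longrightarrow>
        (\<Sum>(x, k)\<in>p. norm (measure lborel k *\<^sub>R f x - integral k f)) < \<eta>"
      using Henstock_lemma[of f a b \<eta>] f by auto
    define K where "K = {(x, y). x \<in> E n \<and> y \<noteq> x \<and> y \<in> {a<..<b} \<and> {min x y..max x y} \<subseteq> \<gamma> x \<and>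
      \<bar>F y - F x - f x * (y - x)\<bar> > \<bar>y - x\<bar> / real (Suc n)}"
    \<comment> \<open>The Vitali theorem speaks of balls, so the interval between x and y is
      described by its midpoint and half-length. The pair keeps track of which endpoint is the
      tag.\<close>
    define c r where "c = (\<lambda>(x, y). (x + y) / 2 :: real)" and "r = (\<lambda>(x, y). \<bar>y - x\<bar> / 2 :: real)"
    define J where "J = (\<lambda>(x, y). {min x y..max x y} :: real set)"
    have J: "cball (c i) (r i) = J i" for i
      by (cases i) (auto simp: c_def r_def J_def cball_eq_atLeastAtMost min_def max_def field_simps)
    have "\<exists>i. i \<in> K \<and> x \<in> cball (c i) (r i) \<and> r i < d" if x: "x \<in> E n" and "d > 0" for x d
    proof -
      obtain e where e: "e > 0" "ball x e \<subseteq> \<gamma> x"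
        using \<gamma> unfolding gauge_def by (meson openE)
      have ab: "a < x" "x < b" using x by (auto simp: E_def)
      obtain y where y: "y \<noteq> x" "\<bar>y - x\<bar> < Min {d, e, x - a, b - x}"
        "\<bar>F y - F x - f x * (y - x)\<bar> > \<bar>y - x\<bar> / real (Suc n)"
        using x[unfolded E_def mem_Collect_eq, THEN conjunct2, rule_format, of "Min {d, e, x - a, b - x}"] e \<open>d > 0\<close> ab
        by auto
      have "{min x y..max x y} \<subseteq> ball x e" using y by (auto simp: dist_real_def)
      then have "(x, y) \<in> K" using x y e ab by (auto simp: K_def)
      moreover have "r (x, y) < d" using y by (auto simp: r_def)
      moreover have "x \<in> J (x, y)" by (auto simp: J_def)
      ultimately show ?thesis unfolding J by blast
    qed
    moreover have "0 < r i" if "i \<in> K" for i using that by (auto simp: K_def r_def)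
    ultimately obtain C where C: "countable C" "C \<subseteq> K"
        "pairwise (\<lambda>i j. disjnt (cball (c i) (r i)) (cball (c j) (r j))) C"
        "negligible (E n - (\<Union>i\<in>C. cball (c i) (r i)))"
      using Vitali_covering_theorem_cballs[of K r "E n" c] by blast
    have fin: "(\<Sum>i\<in>D. measure lebesgue (J i)) \<le> \<mu>" if D: "finite D" "D \<subseteq> C" for D
    proof -
      define p where "p = (\<lambda>i. (fst i, J i)) ` D"
      have disj: "J i \<inter> J j = {}" if "i \<in> D" "j \<in> D" "i \<noteq> j" for i j
        using C(3) D that unfolding pairwise_def J disjnt_def by blast
      have ne: "J i \<noteq> {}" for i by (cases i) (auto simp: J_def)
      \<comment> \<open>The intervals are nonempty and pairwise disjoint, so no two indices collapse
        and the sum over \<open>D\<close> can be reindexed as a sum over \<open>p\<close>.\<close>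
      have inj: "inj_on (\<lambda>i. (fst i, J i)) D"
        by (rule inj_onI) (use disj ne in fastforce)
      have "p tagged_partial_division_of cbox a b"
        unfolding tagged_partial_division_of_def
      proof (intro conjI allI impI)
        show "finite p" using D by (simp add: p_def)
        fix x k assume "(x, k) \<in> p"
        then obtain y where "(x, y) \<in> K" "k = J (x, y)" using C(2) D by (auto simp: p_def)
        then show "x \<in> k" "k \<subseteq> cbox a b" "\<exists>a b. k = cbox a b"
          by (auto simp: K_def E_def J_def)
      next
        fix x k x' k' assume "(x, k) \<in> p \<and> (x', k') \<in> p \<and> (x, k) \<noteq> (x', k')"
        then obtain i j where "i \<in> D" "j \<in> D" "(x, k) = (fst i, J i)" "(x', k') = (fst j, J j)"
          "(x, k) \<noteq> (x', k')"
          unfolding p_def by blast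
        then have "k \<inter> k' = {}" using disj[of i j] by auto
        then show "interior k \<inter> interior k' = {}" using interior_subset by blast
      qed
      moreover have "\<gamma> fine p"
        using C(2) D by (fastforce simp: fine_def p_def K_def J_def)
      ultimately have H: "(\<Sum>(x, k)\<in>p. norm (measure lborel k *\<^sub>R f x - integral k f)) < \<eta>" by (rule henstock)
      have "measure lebesgue (J i) \<le> real (Suc n) * norm (measure lborel (J i) *\<^sub>R f (fst i) - integral (J i) f)" if "i \<in> D" for i
      proof -
        obtain x y where i: "i = (x, y)" "(x, y) \<in> K" using C(2) D \<open>i \<in> D\<close> by (cases i) auto
        then have xy: "a < x" "x < b" "a < y" "y < b"
          "\<bar>F y - F x - f x * (y - x)\<bar> > \<bar>y - x\<bar> / real (Suc n)" by (auto simp: K_def E_def)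
        \<comment> \<open>The tag may be either endpoint of the interval; exchanging the ends only
          changes a sign inside the absolute value.\<close>
        have "\<bar>F y - F x - f x * (y - x)\<bar> = norm (measure lborel (J i) *\<^sub>R f x - integral (J i) f)"
        proof (cases "x \<le> y")
          case True
          then show ?thesis using F[of x y] xy by (simp add: i J_def abs_minus_commute mult.commute)
        next
          case False
          then have "F x - F y = integral {y..x} f" using F[of y x] xy by simp
          then have "F y - F x - f x * (y - x) = measure lborel (J i) *\<^sub>R f x - integral (J i) f"
            using False by (simp add: i J_def algebra_simps)
          then show ?thesis by simp
        qed
        moreover have "measure lebesgue (J i) = \<bar>y - x\<bar>"
          by (auto simp: i J_def)
        ultimately show ?thesis using xy(5) by (simp add: i pos_divide_less_eq mult.commute)
      qed
      then have "(\<Sum>i\<in>D. measure lebesgue (J i)) \<le> (\<Sum>i\<in>D. real (Suc n) * norm (measure lborel (J i) *\<^sub>R f (fst i) - integral (J i) f))"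
        by (rule sum_mono)
      also have "\<dots> = real (Suc n) * (\<Sum>(x, k)\<in>p. norm (measure lborel k *\<^sub>R f x - integral k f))"
        unfolding p_def sum.reindex[OF inj] by (simp add: sum_distrib_left o_def)
      also have "\<dots> \<le> real (Suc n) * \<eta>" using H by (intro mult_left_mono) auto
      also have "\<dots> = \<mu>" by (simp add: \<eta>_def del: of_nat_Suc)
      finally show ?thesis .
    qed
    \<comment> \<open>The bound for all finite subfamilies passes to the countable union.\<close>
    have "(\<Union>i\<in>C. J i) \<in> lmeasurable \<and> measure lebesgue (\<Union>i\<in>C. J i) \<le> \<mu>"
    proof (rule conjI)
      have Jm: "J i \<in> lmeasurable" for i by (cases i) (simp add: J_def)
      have bound: "measure lebesgue (\<Union>i\<in>D. J i) \<le> \<mu>" if "D \<subseteq> C" "finite D" for D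
        using measure_UNION_le[OF that(2), of J lebesgue] fin[OF that(2,1)] Jm by force
      show "(\<Union>i\<in>C. J i) \<in> lmeasurable"
        by (rule fmeasurable_UN_bound[OF C(1) Jm bound])
      show "measure lebesgue (\<Union>i\<in>C. J i) \<le> \<mu>"
        by (rule measure_UN_bound[OF C(1) Jm bound])
    qed
    moreover have "E n - (\<Union>i\<in>C. J i) \<in> lmeasurable" "measure lebesgue (E n - (\<Union>i\<in>C. J i)) = 0"
      using C(4) unfolding J by (auto simp: negligible_iff_measure)
    ultimately show "\<exists>T. E n \<subseteq> T \<and> T \<in> lmeasurable \<and> measure lebesgue T \<le> \<mu>"
      by (intro exI[of _ "(\<Union>i\<in>C. J i) \<union> (E n - (\<Union>i\<in>C. J i))"] conjI
          order_trans[OF measure_Un_le] fmeasurable.Un fmeasurableD) (blast | simp del: Un_Diff_cancel)+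
  qed
  then have "negligible (\<Union>n. E n)" by (intro negligible_countable_Union) auto
  moreover have "{x \<in> {a<..<b}. \<not> (F has_real_derivative f x) (at x)} \<subseteq> (\<Union>n. E n)"
  proof (rule subsetI, rule ccontr)
    fix x assume x: "x \<in> {x \<in> {a<..<b}. \<not> (F has_real_derivative f x) (at x)}" and n: "x \<notin> (\<Union>n. E n)"
    have "(F has_real_derivative f x) (at x)"
      unfolding has_field_derivative_def has_derivative_at_alt
    proof (intro conjI allI impI bounded_linear_mult_right)
      fix e :: real assume "e > 0"
      then obtain n where "1 / real (Suc n) < e" by (metis inverse_eq_divide reals_Archimedean)
      then have n': "t / real (Suc n) \<le> e * t" if "t \<ge> 0" for t
        using mult_right_mono[of "1 / real (Suc n)" e t] that by simp
      have "x \<notin> E n" using n by blast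
      then obtain d where d: "d > 0" "\<And>y. \<not> (y \<noteq> x \<and> \<bar>y - x\<bar> < d \<and>
          \<bar>F y - F x - f x * (y - x)\<bar> > \<bar>y - x\<bar> / real (Suc n))"
        using x unfolding E_def by blast
      show "\<exists>d>0. \<forall>y. norm (y - x) < d \<longrightarrow> norm (F y - F x - f x * (y - x)) \<le> e * norm (y - x)"
      proof (intro exI[of _ d] conjI allI impI d(1))
        fix y assume "norm (y - x) < d"
        then show "norm (F y - F x - f x * (y - x)) \<le> e * norm (y - x)"
          using d(2)[of y] n'[of "\<bar>y - x\<bar>"] by (cases "y = x") auto
      qed
    qed
    then show False using x by simp
  qed
  ultimately show ?thesis unfolding F_def by (rule negligible_subset)
qed

text \<open>
  The gauge keeps the division intervals tagged in the exceptional set inside an open set of small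
  measure, where absolute continuity applies; on the others the zero derivative bounds the increment.
\<close>

lemma abs_continuous_zero_derivative_imp_eq:
  fixes f :: "real \<Rightarrow> real"
  assumes "a \<le> b" and ac: "abs_continuous_on a b f" and N: "negligible N"
    and der: "\<And>x. x \<in> {a<..<b} - N \<Longrightarrow> (f has_real_derivative 0) (at x)"
  shows "f b = f a"
proof -
  have "\<bar>f b - f a\<bar> \<le> e * (b - a + 1)" if "e > 0" for e
  proof -
    obtain \<delta> where \<delta>: "\<delta> > 0" and small: "\<forall>(n::nat) (s::nat \<Rightarrow> real) t.
        (\<forall>i<n. a \<le> s i \<and> s i \<le> t i \<and> t i \<le> b) \<and>
        disjoint_family_on (\<lambda>i. {s i<..<t i}) {..<n} \<and>
        (\<Sum>i<n. t i - s i) < \<delta> \<longrightarrow> (\<Sum>i<n. \<bar>f (t i) - f (s i)\<bar>) < e"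
      using ac[unfolded abs_continuous_on_def, rule_format, OF \<open>e > 0\<close>] by blast
    \<comment> \<open>The endpoints join the exceptional set, since the derivative is known only in
      the open interval.\<close>
    define N' where "N' = N \<union> {a, b}"
    have N': "negligible N'" using N by (simp add: N'_def)
    then have N'0: "N' \<in> null_sets lebesgue" by (simp add: negligible_iff_null_sets)
    obtain T where T: "open T" "N' \<subseteq> T" "T - N' \<in> lmeasurable" "emeasure lebesgue (T - N') < ennreal \<delta>"
      using sets_lebesgue_outer_open[of N' \<delta>] N'0 \<delta> by blast
    have Tm: "emeasure lebesgue T < ennreal \<delta>"
      using T(4) emeasure_Diff_null_set[OF N'0, of T] T(1) by (simp add: borel_open)
    have "\<exists>d>0. (x \<in> N' \<longrightarrow> ball x d \<subseteq> T) \<and>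
      (x \<in> {a..b} - N' \<longrightarrow> (\<forall>y. \<bar>y - x\<bar> < d \<longrightarrow> \<bar>f y - f x\<bar> \<le> e * \<bar>y - x\<bar>))" for x
    proof (cases "x \<in> {a..b} - N'")
      case True
      then have "(f has_real_derivative 0) (at x)" by (intro der) (auto simp: N'_def)
      then show ?thesis
        using True \<open>e > 0\<close> unfolding has_field_derivative_def has_derivative_at_alt by auto
    next
      case False
      then show ?thesis
        using T(1,2) by (metis gt_ex openE subsetD)
    qed
    then obtain d where d: "\<And>x. d x > 0" "\<And>x. x \<in> N' \<Longrightarrow> ball x (d x) \<subseteq> T"
      "\<And>x y. x \<in> {a..b} - N' \<Longrightarrow> \<bar>y - x\<bar> < d x \<Longrightarrow> \<bar>f y - f x\<bar> \<le> e * \<bar>y - x\<bar>"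
      by metis
    have "gauge (\<lambda>x. ball x (d x))" using d(1) by (intro gauge_ball_dependent) auto
    then obtain p where p: "p tagged_division_of {a..b}" "(\<lambda>x. ball x (d x)) fine p"
      by (rule fine_division_exists_real)
    have finp: "finite p" using p(1) by blast
    have pk: "\<exists>l u. k = {l..u} \<and> l \<le> x \<and> x \<le> u \<and> a \<le> l \<and> u \<le> b \<and> k \<subseteq> ball x (d x)" if xk: "(x, k) \<in> p" for x k
    proof -
      obtain l u where "k = cbox l u" using tagged_division_ofD(4)[OF p(1) xk] by blast
      moreover have "x \<in> k" "k \<subseteq> {a..b}" using tagged_division_ofD(2,3)[OF p(1) xk] by auto
      moreover have "k \<subseteq> ball x (d x)" using p(2) xk by (auto simp: fine_def)
      ultimately show ?thesis by auto
    qed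
    define q where "q = {(x, k) \<in> p. x \<in> N'}"
    have q: "finite q" "q \<subseteq> p" using finp by (auto simp: q_def intro: finite_subset)
    have len: "(\<Sum>(x, k)\<in>p. Sup k - Inf k) = b - a"
      using additive_tagged_division_1[OF \<open>a \<le> b\<close> p(1), of "\<lambda>x. x"] .
    have 1: "(\<Sum>(x, k)\<in>p - q. \<bar>f (Sup k) - f (Inf k)\<bar>) \<le> e * (b - a)"
    proof -
      have "(\<Sum>(x, k)\<in>p - q. \<bar>f (Sup k) - f (Inf k)\<bar>) \<le> (\<Sum>(x, k)\<in>p - q. e * (Sup k - Inf k))"
      proof (rule sum_mono, clarify)
        fix x k assume xk: "(x, k) \<in> p" "(x, k) \<notin> q"
        then obtain l u where k: "k = {l..u}" "l \<le> x" "x \<le> u" "a \<le> l" "u \<le> b" "k \<subseteq> ball x (d x)"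
          using pk by blast
        then have "l \<in> k" "u \<in> k" by auto
        then have "l \<in> ball x (d x)" "u \<in> ball x (d x)" using k(6) by blast+
        then have "x \<in> {a..b} - N'" "\<bar>l - x\<bar> < d x" "\<bar>u - x\<bar> < d x"
          using xk k by (auto simp: q_def dist_real_def)
        then have "\<bar>f l - f x\<bar> \<le> e * (x - l)" "\<bar>f u - f x\<bar> \<le> e * (u - x)"
          using d(3)[of x l] d(3)[of x u] k by auto
        \<comment> \<open>The tag lies between \<open>l\<close> and \<open>u\<close>, so the two
          one-sided estimates add up to the full length.\<close>
        then have "\<bar>f u - f l\<bar> \<le> e * (u - l)" by (simp add: algebra_simps)
        then show "\<bar>f (Sup k) - f (Inf k)\<bar> \<le> e * (Sup k - Inf k)" using k by simp
      qed
      also have "\<dots> \<le> (\<Sum>(x, k)\<in>p. e * (Sup k - Inf k))"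
      proof (rule sum_mono2[OF finp])
        fix i assume "i \<in> p - (p - q)"
        then show "0 \<le> (case i of (x, k) \<Rightarrow> e * (Sup k - Inf k))"
          using pk[of "fst i" "snd i"] \<open>e > 0\<close> by (auto simp: case_prod_unfold)
      qed auto
      also have "\<dots> = e * (b - a)" unfolding len[symmetric] by (simp add: sum_distrib_left case_prod_unfold)
      finally show ?thesis .
    qed
    have 2: "(\<Sum>(x, k)\<in>q. \<bar>f (Sup k) - f (Inf k)\<bar>) < e"
    proof -
      \<comment> \<open>Absolute continuity is phrased with indexed families, so the intervals
        tagged in the exceptional set are enumerated.\<close>
      obtain h where h: "bij_betw h {..<card q} q"
        using ex_bij_betw_nat_finite[OF q(1)] by (auto simp: atLeast0LessThan)
      define s t where "s = (\<lambda>i. Inf (snd (h i)))" and "t = (\<lambda>i. Sup (snd (h i)))"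
      have hk: "snd (h i) = {s i..t i} \<and> s i \<le> fst (h i) \<and> fst (h i) \<le> t i \<and> a \<le> s i \<and> t i \<le> b \<and>
          snd (h i) \<subseteq> T \<and> h i \<in> p" if "i < card q" for i
      proof -
        have "h i \<in> q" using h that by (auto simp: bij_betw_def)
        then have "(fst (h i), snd (h i)) \<in> p" "fst (h i) \<in> N'" by (auto simp: q_def)
        then show ?thesis using pk[of "fst (h i)" "snd (h i)"] d(2)[of "fst (h i)"] by (auto simp: s_def t_def)
      qed
      have disj: "disjoint_family_on (\<lambda>i. {s i<..<t i}) {..<card q}"
      proof (unfold disjoint_family_on_def, intro ballI impI)
        fix i j assume ij: "i \<in> {..<card q}" "j \<in> {..<card q}" "i \<noteq> j"
        then have "h i \<noteq> h j" using h by (auto simp: bij_betw_def inj_on_def)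
        then have "interior (snd (h i)) \<inter> interior (snd (h j)) = {}"
          using tagged_division_ofD(5)[OF p(1), of "fst (h i)" "snd (h i)" "fst (h j)" "snd (h j)"] hk ij
          by (metis lessThan_iff prod.collapse)
        moreover have "snd (h i) = {s i..t i}" "snd (h j) = {s j..t j}" using hk ij by auto
        ultimately show "{s i<..<t i} \<inter> {s j<..<t j} = {}" by simp
      qed
      have st: "s i \<le> t i" "a \<le> s i" "t i \<le> b" "{s i<..<t i} \<subseteq> T" if "i < card q" for i
        using hk[OF that] by (force+)
      \<comment> \<open>The total length is the measure of a disjoint union contained in
        \<open>T\<close>, hence below \<delta>.\<close>
      have "(\<Sum>i<card q. t i - s i) = (\<Sum>i<card q. measure lebesgue {s i<..<t i})"
        using st by (intro sum.cong) auto
      also have "\<dots> = measure lebesgue (\<Union>i<card q. {s i<..<t i})"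
        using disj st by (intro measure_finite_Union[symmetric]) auto
      also have "\<dots> < \<delta>"
      proof -
        have "emeasure lebesgue (\<Union>i<card q. {s i<..<t i}) \<le> emeasure lebesgue T"
        proof (rule emeasure_mono)
          show "(\<Union>i<card q. {s i<..<t i}) \<subseteq> T" using st(4) by blast
        qed (use T(1) in \<open>simp add: borel_open\<close>)
        then have "emeasure lebesgue (\<Union>i<card q. {s i<..<t i}) < ennreal \<delta>" using Tm by order
        then show ?thesis
          unfolding measure_def using \<delta> enn2real_less_iff less_top order_less_trans by metis
      qed
      finally have "(\<Sum>i<card q. \<bar>f (t i) - f (s i)\<bar>) < e"
        by (intro small[rule_format] conjI disj) (auto simp: st)
      also have "(\<Sum>i<card q. \<bar>f (t i) - f (s i)\<bar>) = (\<Sum>(x, k)\<in>q. \<bar>f (Sup k) - f (Inf k)\<bar>)"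
        unfolding s_def t_def case_prod_unfold by (rule sum.reindex_bij_betw[OF h])
      finally show ?thesis .
    qed
    have "f b - f a = (\<Sum>(x, k)\<in>p. f (Sup k) - f (Inf k))"
      using additive_tagged_division_1[OF \<open>a \<le> b\<close> p(1), of f] by simp
    then have "\<bar>f b - f a\<bar> \<le> (\<Sum>(x, k)\<in>p. \<bar>f (Sup k) - f (Inf k)\<bar>)"
      by (simp add: case_prod_unfold sum_abs)
    also have "\<dots> = (\<Sum>(x, k)\<in>p - q. \<bar>f (Sup k) - f (Inf k)\<bar>) + (\<Sum>(x, k)\<in>q. \<bar>f (Sup k) - f (Inf k)\<bar>)"
      by (rule sum.subset_diff[OF q(2) finp])
    also have "\<dots> \<le> e * (b - a + 1)" using 1 2 by (simp add: algebra_simps)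
    finally show ?thesis .
  qed
  note bound = this
  have "\<bar>f b - f a\<bar> \<le> 0"
  proof (rule field_le_epsilon)
    fix e :: real assume "e > 0"
    \<comment> \<open>The summand 1 in b - a + 1 accounts for the exceptional intervals and keeps
      the divisor positive when a = b.\<close>
    then show "\<bar>f b - f a\<bar> \<le> 0 + e"
      using bound[of "e / (b - a + 1)"] \<open>a \<le> b\<close> by auto
  qed
  then show ?thesis by simp
qed

section \<open>Absolute continuity of primitives and closure properties\<close>

text \<open>Truncation at height k splits |f| into a part bounded by k and a remainder whose
  integral tends to 0. The remainder costs less than \<epsilon>/2 over any disjoint family, and the
  bounded part costs at most k times the total length.\<close>

lemma abs_continuous_on_indefinite_integral:
  fixes f :: "real \<Rightarrow> real"
  assumes f: "f absolutely_integrable_on {a..b}"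
  shows "abs_continuous_on a b (\<lambda>x. integral {a..x} f)"
  unfolding abs_continuous_on_def
proof (intro allI impI)
  fix \<epsilon> :: real assume "\<epsilon> > 0"
  define r where "r = (\<lambda>(k::nat) x. \<bar>f x\<bar> - min \<bar>f x\<bar> (real k))"
  have fint: "f integrable_on {a..b}" and aint: "(\<lambda>x. \<bar>f x\<bar>) integrable_on {a..b}"
    using f unfolding absolutely_integrable_on_def real_norm_def by blast+
  have af: "(\<lambda>x. \<bar>f x\<bar>) absolutely_integrable_on {a..b}"
    using set_integrable_abs[OF f] by simp
  have rint: "r k absolutely_integrable_on {a..b}" for k
    unfolding r_def
    by (intro set_integral_diff absolutely_integrable_min_1 af absolutely_integrable_on_const) auto
  then have rint': "r k integrable_on {a..b}" for k
    by (rule set_lebesgue_integral_eq_integral)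
  have r0: "0 \<le> r k x" "\<bar>f x\<bar> \<le> real k + r k x" for k x by (auto simp: r_def)
  have "(\<lambda>k. integral {a..b} (r k)) \<longlonglongrightarrow> integral {a..b} (\<lambda>x. 0)"
  proof (rule dominated_convergence[OF rint' aint])
    show "norm (r k x) \<le> \<bar>f x\<bar>" for k x by (auto simp: r_def)
    fix x
    have "\<forall>\<^sub>F k in sequentially. r k x = 0"
    proof -
      obtain N :: nat where "\<bar>f x\<bar> \<le> real N" using real_arch_simple by blast
      then show ?thesis by (auto simp: eventually_sequentially r_def intro!: exI[of _ N])
    qed
    then show "(\<lambda>k. r k x) \<longlonglongrightarrow> 0" by (rule tendsto_eventually)
  qed
  then have "(\<lambda>k. integral {a..b} (r k)) \<longlonglongrightarrow> 0" by simp
  then have "\<forall>\<^sub>F k in sequentially. integral {a..b} (r k) < \<epsilon> / 2"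
    using \<open>\<epsilon> > 0\<close> by (intro order_tendstoD) auto
  then obtain k where k: "integral {a..b} (r k) < \<epsilon> / 2"
    by (auto simp: eventually_sequentially)
  \<comment> \<open>The threshold has k + 1 rather than k in the denominator so that it also makes
    sense for k = 0.\<close>
  have "(\<Sum>i<n. \<bar>integral {a..t i} f - integral {a..s i} f\<bar>) < \<epsilon>"
    if st: "\<forall>i<n. a \<le> s i \<and> s i \<le> t i \<and> t i \<le> b"
      and disj: "disjoint_family_on (\<lambda>i. {s i<..<t i}) {..<n}"
      and less: "(\<Sum>i<n. t i - s i) < \<epsilon> / (2 * (real k + 1))" for n :: nat and s t :: "nat \<Rightarrow> real"
  proof -
    \<comment> \<open>Only the open intervals are disjoint, so the remainder is restricted to those;
      the omitted endpoints do not change the integral.\<close>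
    have restr: "integral {s i..t i} (r k) = integral {a..b} (\<lambda>x. if x \<in> {s i<..<t i} then r k x else 0)"
      and restr_int: "(\<lambda>x. if x \<in> {s i<..<t i} then r k x else 0) integrable_on {a..b}" if "i < n" for i
    proof -
      have sub: "{s i<..<t i} \<inter> {a..b} = {s i<..<t i}" using st that by fastforce
      have "r k integrable_on {s i..t i}"
        using st that by (intro integrable_subinterval_real[OF rint']) auto
      then show "(\<lambda>x. if x \<in> {s i<..<t i} then r k x else 0) integrable_on {a..b}"
        unfolding Henstock_Kurzweil_Integration.integrable_restrict_Int sub by (simp add: integrable_on_Icc_iff_Ioo)
      show "integral {s i..t i} (r k) = integral {a..b} (\<lambda>x. if x \<in> {s i<..<t i} then r k x else 0)"
        unfolding Henstock_Kurzweil_Integration.integral_restrict_Int sub by (rule integral_open_interval_real)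
    qed
    have "\<bar>integral {a..t i} f - integral {a..s i} f\<bar> \<le> real k * (t i - s i) + integral {s i..t i} (r k)"
      if "i < n" for i
    proof -
      have i: "a \<le> s i" "s i \<le> t i" "t i \<le> b" using st that by auto
      have int: "f integrable_on {s i..t i}" "r k integrable_on {s i..t i}"
        using i by (auto intro: integrable_subinterval_real[OF fint] integrable_subinterval_real[OF rint'])
      have "integral {a..t i} f - integral {a..s i} f = integral {s i..t i} f"
        using Henstock_Kurzweil_Integration.integral_combine[OF i(1,2), of f] i
          integrable_subinterval_real[OF fint, of a "t i"] by auto
      also have "\<bar>\<dots>\<bar> \<le> integral {s i..t i} (\<lambda>x. real k + r k x)"
        using integral_norm_bound_integral[of f "{s i..t i}" "\<lambda>x. real k + r k x"] int r0
          integrable_add[OF integrable_const_ivl[of "real k"] int(2)] by simp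
      also have "\<dots> = real k * (t i - s i) + integral {s i..t i} (r k)"
        using int i by (subst Henstock_Kurzweil_Integration.integral_add) auto
      finally show ?thesis .
    qed
    then have "(\<Sum>i<n. \<bar>integral {a..t i} f - integral {a..s i} f\<bar>) \<le>
        (\<Sum>i<n. real k * (t i - s i) + integral {s i..t i} (r k))"
      by (intro sum_mono) auto
    also have "\<dots> = real k * (\<Sum>i<n. t i - s i) + (\<Sum>i<n. integral {s i..t i} (r k))"
      by (simp add: sum.distrib sum_distrib_left)
    also have "real k * (\<Sum>i<n. t i - s i) \<le> (real k + 1) * (\<Sum>i<n. t i - s i)"
      using st by (intro mult_right_mono sum_nonneg) auto
    also have "\<dots> < \<epsilon> / 2" using less by (simp add: field_simps)
    also have "(\<Sum>i<n. integral {s i..t i} (r k)) =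
        integral {a..b} (\<lambda>x. \<Sum>i<n. if x \<in> {s i<..<t i} then r k x else 0)"
      using restr restr_int by (subst integral_sum) auto
    also have "\<dots> \<le> integral {a..b} (r k)"
    proof (rule integral_le[OF _ rint'])
      show "(\<lambda>x. \<Sum>i<n. if x \<in> {s i<..<t i} then r k x else 0) integrable_on {a..b}"
        using restr_int by (intro integrable_sum) auto
      fix x
      \<comment> \<open>By disjointness at most one summand is active at x.\<close>
      show "(\<Sum>i<n. if x \<in> {s i<..<t i} then r k x else 0) \<le> r k x"
      proof (cases "\<exists>i<n. x \<in> {s i<..<t i}")
        case True
        then obtain i where i: "i < n" "x \<in> {s i<..<t i}" by blast
        then have "x \<notin> {s j<..<t j}" if "j < n" "j \<noteq> i" for j
          using disj that unfolding disjoint_family_on_def by fastforce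
        then have "(\<Sum>j<n. if x \<in> {s j<..<t j} then r k x else 0) = (\<Sum>j<n. if j = i then r k x else 0)"
          using i by (intro sum.cong) auto
        then show ?thesis using i by simp
      next
        case False
        then have "(\<Sum>i<n. if x \<in> {s i<..<t i} then r k x else 0) = 0" by (intro sum.neutral) auto
        then show ?thesis using r0 by simp
      qed
    qed
    finally show ?thesis using k by linarith
  qed
  then show "\<exists>\<delta>>0. \<forall>(n::nat) (s::nat \<Rightarrow> real) t.
      (\<forall>i<n. a \<le> s i \<and> s i \<le> t i \<and> t i \<le> b) \<and>
      disjoint_family_on (\<lambda>i. {s i<..<t i}) {..<n} \<and> (\<Sum>i<n. t i - s i) < \<delta> \<longrightarrow>
      (\<Sum>i<n. \<bar>integral {a..t i} f - integral {a..s i} f\<bar>) < \<epsilon>"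
    using \<open>\<epsilon> > 0\<close> by (intro exI[of _ "\<epsilon> / (2 * (real k + 1))"]) auto
qed

lemma abs_continuous_on_diff:
  assumes "abs_continuous_on a b f" "abs_continuous_on a b g"
  shows "abs_continuous_on a b (\<lambda>x. f x - g x)"
  unfolding abs_continuous_on_def
proof (intro allI impI)
  fix \<epsilon> :: real assume "\<epsilon> > 0"
  then have "\<epsilon> / 2 > 0" by simp
  obtain d1 where d1: "d1 > 0" "\<forall>(n::nat) (s::nat \<Rightarrow> real) t.
        (\<forall>i<n. a \<le> s i \<and> s i \<le> t i \<and> t i \<le> b) \<and> disjoint_family_on (\<lambda>i. {s i<..<t i}) {..<n} \<and>
        (\<Sum>i<n. t i - s i) < d1 \<longrightarrow> (\<Sum>i<n. \<bar>f (t i) - f (s i)\<bar>) < \<epsilon> / 2"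
    using assms(1)[unfolded abs_continuous_on_def, rule_format, OF \<open>\<epsilon> / 2 > 0\<close>] by blast
  obtain d2 where d2: "d2 > 0" "\<forall>(n::nat) (s::nat \<Rightarrow> real) t.
        (\<forall>i<n. a \<le> s i \<and> s i \<le> t i \<and> t i \<le> b) \<and> disjoint_family_on (\<lambda>i. {s i<..<t i}) {..<n} \<and>
        (\<Sum>i<n. t i - s i) < d2 \<longrightarrow> (\<Sum>i<n. \<bar>g (t i) - g (s i)\<bar>) < \<epsilon> / 2"
    using assms(2)[unfolded abs_continuous_on_def, rule_format, OF \<open>\<epsilon> / 2 > 0\<close>] by blast
  show "\<exists>\<delta>>0. \<forall>(n::nat) (s::nat \<Rightarrow> real) t.
      (\<forall>i<n. a \<le> s i \<and> s i \<le> t i \<and> t i \<le> b) \<and>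
      disjoint_family_on (\<lambda>i. {s i<..<t i}) {..<n} \<and> (\<Sum>i<n. t i - s i) < \<delta> \<longrightarrow>
      (\<Sum>i<n. \<bar>f (t i) - g (t i) - (f (s i) - g (s i))\<bar>) < \<epsilon>"
  proof (intro exI[of _ "min d1 d2"] conjI allI impI)
    fix n :: nat and s t :: "nat \<Rightarrow> real"
    assume *: "(\<forall>i<n. a \<le> s i \<and> s i \<le> t i \<and> t i \<le> b) \<and>
      disjoint_family_on (\<lambda>i. {s i<..<t i}) {..<n} \<and> (\<Sum>i<n. t i - s i) < min d1 d2"
    have "(\<Sum>i<n. \<bar>f (t i) - g (t i) - (f (s i) - g (s i))\<bar>) \<le>
        (\<Sum>i<n. \<bar>f (t i) - f (s i)\<bar> + \<bar>g (t i) - g (s i)\<bar>)"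
      by (intro sum_mono) linarith
    also have "\<dots> < \<epsilon> / 2 + \<epsilon> / 2"
      unfolding sum.distrib
      using d1(2)[rule_format, of n s t] d2(2)[rule_format, of n s t] * by (intro add_strict_mono) auto
    finally show "(\<Sum>i<n. \<bar>f (t i) - g (t i) - (f (s i) - g (s i))\<bar>) < \<epsilon>" by simp
  qed (use d1 d2 in auto)
qed

lemma abs_continuous_on_const: "abs_continuous_on a b (\<lambda>x. c)"
  unfolding abs_continuous_on_def using zero_less_one by auto

lemma abs_continuous_on_cong:
  assumes "abs_continuous_on a b f" "\<And>x. x \<in> {a..b} \<Longrightarrow> f x = g x"
  shows "abs_continuous_on a b g"
proof -
  have eq: "(\<Sum>i<n. \<bar>g (t i) - g (s i)\<bar>) = (\<Sum>i<n. \<bar>f (t i) - f (s i)\<bar>)"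
    if "\<forall>i<n. a \<le> s i \<and> s i \<le> t i \<and> t i \<le> b" for n :: nat and s t :: "nat \<Rightarrow> real"
    using that assms(2) by (intro sum.cong) force+
  show ?thesis
    unfolding abs_continuous_on_def
  proof (intro allI impI)
    fix \<epsilon> :: real assume "\<epsilon> > 0"
    obtain \<delta> where "\<delta> > 0" and \<delta>: "\<forall>(n::nat) (s::nat \<Rightarrow> real) t.
        (\<forall>i<n. a \<le> s i \<and> s i \<le> t i \<and> t i \<le> b) \<and> disjoint_family_on (\<lambda>i. {s i<..<t i}) {..<n} \<and>
        (\<Sum>i<n. t i - s i) < \<delta> \<longrightarrow> (\<Sum>i<n. \<bar>f (t i) - f (s i)\<bar>) < \<epsilon>"
      using assms(1)[unfolded abs_continuous_on_def, rule_format, OF \<open>\<epsilon> > 0\<close>] by blast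
    show "\<exists>\<delta>>0. \<forall>(n::nat) (s::nat \<Rightarrow> real) t.
      (\<forall>i<n. a \<le> s i \<and> s i \<le> t i \<and> t i \<le> b) \<and>
      disjoint_family_on (\<lambda>i. {s i<..<t i}) {..<n} \<and> (\<Sum>i<n. t i - s i) < \<delta> \<longrightarrow>
      (\<Sum>i<n. \<bar>g (t i) - g (s i)\<bar>) < \<epsilon>"
    proof (intro exI[of _ \<delta>] conjI allI impI \<open>\<delta> > 0\<close>)
      fix n :: nat and s t :: "nat \<Rightarrow> real"
      assume "(\<forall>i<n. a \<le> s i \<and> s i \<le> t i \<and> t i \<le> b) \<and>
        disjoint_family_on (\<lambda>i. {s i<..<t i}) {..<n} \<and> (\<Sum>i<n. t i - s i) < \<delta>"
      then show "(\<Sum>i<n. \<bar>g (t i) - g (s i)\<bar>) < \<epsilon>"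
        using \<delta>[rule_format, of n s t] eq[of n s t] by simp
    qed
  qed
qed

lemma abs_continuous_on_subinterval:
  assumes "abs_continuous_on a b f" "a \<le> c" "d \<le> b"
  shows "abs_continuous_on c d f"
  unfolding abs_continuous_on_def
proof (intro allI impI)
  fix \<epsilon> :: real assume "\<epsilon> > 0"
  obtain \<delta> where \<delta>: "\<delta> > 0" "\<forall>(n::nat) (s::nat \<Rightarrow> real) t.
        (\<forall>i<n. a \<le> s i \<and> s i \<le> t i \<and> t i \<le> b) \<and> disjoint_family_on (\<lambda>i. {s i<..<t i}) {..<n} \<and>
        (\<Sum>i<n. t i - s i) < \<delta> \<longrightarrow> (\<Sum>i<n. \<bar>f (t i) - f (s i)\<bar>) < \<epsilon>"
    using assms(1)[unfolded abs_continuous_on_def, rule_format, OF \<open>\<epsilon> > 0\<close>] by blast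
  show "\<exists>\<delta>>0. \<forall>(n::nat) (s::nat \<Rightarrow> real) t.
      (\<forall>i<n. c \<le> s i \<and> s i \<le> t i \<and> t i \<le> d) \<and>
      disjoint_family_on (\<lambda>i. {s i<..<t i}) {..<n} \<and> (\<Sum>i<n. t i - s i) < \<delta> \<longrightarrow>
      (\<Sum>i<n. \<bar>f (t i) - f (s i)\<bar>) < \<epsilon>"
  proof (intro exI[of _ \<delta>] conjI allI impI \<delta>(1))
    fix n :: nat and s t :: "nat \<Rightarrow> real"
    assume *: "(\<forall>i<n. c \<le> s i \<and> s i \<le> t i \<and> t i \<le> d) \<and>
      disjoint_family_on (\<lambda>i. {s i<..<t i}) {..<n} \<and> (\<Sum>i<n. t i - s i) < \<delta>"
    then have "\<forall>i<n. a \<le> s i \<and> s i \<le> t i \<and> t i \<le> b"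
      using assms(2,3) by force
    with * show "(\<Sum>i<n. \<bar>f (t i) - f (s i)\<bar>) < \<epsilon>"
      using \<delta>(2)[rule_format, of n s t] by simp
  qed
qed

subsection \<open>The solution operator\<close>

text \<open>Splitting into positive and negative parts replaces the case distinction and the
  exponent p - 2, which may be negative, by powers with exponent p - 1. For 1 < p, continuity and
  monotonicity can be read off.\<close>

lemma phi_eq: "phi p t = max t 0 powr (p - 1) - max (- t) 0 powr (p - 1)"
  using powr_mult_base[of t "p - 2"] powr_mult_base[of "- t" "p - 2"]
  by (cases t "0::real" rule: linorder_cases) (auto simp: phi_def mult.commute)

lemma continuous_on_phi: "1 < p \<Longrightarrow> continuous_on S (phi p)"
  unfolding phi_eq by (intro continuous_on_diff continuous_on_powr' continuous_intros) auto

lemma phi_strict_mono: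
  assumes "1 < p" "s < t"
  shows "phi p s < phi p t"
proof (cases "t > 0")
  case True
  then have "max s 0 powr (p - 1) < max t 0 powr (p - 1)"
    using assms by (intro powr_less_mono2) auto
  moreover have "max (- t) 0 powr (p - 1) = 0" using True by simp
  moreover have "0 \<le> max (- s) 0 powr (p - 1)" by simp
  ultimately show ?thesis unfolding phi_eq by linarith
next
  case False
  then have "max (- t) 0 powr (p - 1) < max (- s) 0 powr (p - 1)"
    using assms by (intro powr_less_mono2) auto
  then show ?thesis
    using False assms by (simp add: phi_eq max_def)
qed

lemma phi_mult:
  assumes "s > 0"
  shows "phi p (s * t) = s powr (p - 1) * phi p t"
  using assms powr_mult_base[of s "p - 2"]
  by (auto simp: phi_def abs_mult powr_mult mult.commute)

text \<open>The product is |t|^p, written as |t|^(p - 2) t^2 to expose its sign and its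
  zeros.\<close>

lemma phi_mult_self: "phi p t * t \<ge> 0" "phi p t * t = 0 \<longleftrightarrow> t = 0"
proof -
  have eq: "phi p t * t = \<bar>t\<bar> powr (p - 2) * (t * t)" by (simp add: phi_def)
  show "phi p t * t \<ge> 0" "phi p t * t = 0 \<longleftrightarrow> t = 0" unfolding eq by auto
qed

text \<open>The conjugate exponent satisfies p' - 1 = 1 / (p - 1), so the two powers undo each
  other; this inverts the flux to recover the derivative.\<close>

lemma phi_conjugate:
  assumes "1 < p"
  shows "phi p (phi (p / (p - 1)) t) = t"
proof -
  have q: "(p / (p - 1) - 1) * (p - 1) = 1" using assms by (simp add: field_simps)
  have 1: "(s powr (p / (p - 1) - 1)) powr (p - 1) = s" if "s > 0" for s
    using that by (simp add: powr_powr q)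
  show ?thesis
    using 1[of t] 1[of "- t"] assms by (cases t "0::real" rule: linorder_cases) (auto simp: phi_eq max_def)
qed

section \<open>Comparison and uniqueness\<close>

text \<open>If v - u were negative at x, the mean value theorem would give points \<xi> < x < \<eta>
  where its derivative is negative and positive respectively. Strict monotonicity of
  \<open>phi\<close> carries these signs over to the difference of the fluxes, which would then
  increase from \<xi> to \<eta>.\<close>

lemma phi_comparison:
  assumes "1 < p"
    and cont: "continuous_on {a..b} v" "continuous_on {a..b} u"
    and v: "\<And>x. x \<in> {a<..<b} \<Longrightarrow> (v has_real_derivative v' x) (at x)"
    and u: "\<And>x. x \<in> {a<..<b} \<Longrightarrow> (u has_real_derivative u' x) (at x)"
    and bdry: "v a = u a" "v b = u b"
    and anti: "\<And>x y. a < x \<Longrightarrow> x \<le> y \<Longrightarrow> y < b \<Longrightarrow> phi p (v' y) - phi p (u' y) \<le> phi p (v' x) - phi p (u' x)"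
    and x: "x \<in> {a..b}"
  shows "u x \<le> v x"
proof (rule ccontr)
  assume neg: "\<not> u x \<le> v x"
  then have ab: "a < x" "x < b" using bdry x by (auto simp: order_less_le)
  define z where "z = (\<lambda>t. v t - u t)"
  have cz: "continuous_on S z" if "S \<subseteq> {a..b}" for S
    unfolding z_def using that by (auto intro!: continuous_intros continuous_on_subset[OF cont(1)] continuous_on_subset[OF cont(2)])
  have dz: "(z has_real_derivative v' t - u' t) (at t)" if "t \<in> {a<..<b}" for t
    unfolding z_def using that by (intro DERIV_diff v u)
  have dz': "z differentiable (at t)" if "a < t" "t < b" for t
    using dz that real_differentiable_def by auto
  have "continuous_on {a..x} z" "continuous_on {x..b} z" using ab by (auto intro!: cz)
  obtain l \<xi> where \<xi>: "a < \<xi>" "\<xi> < x" "DERIV z \<xi> :> l" "z x - z a = (x - a) * l"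
    using MVT[OF ab(1) \<open>continuous_on {a..x} z\<close>] dz' ab by auto
  obtain r \<eta> where \<eta>: "x < \<eta>" "\<eta> < b" "DERIV z \<eta> :> r" "z b - z x = (b - x) * r"
    using MVT[OF ab(2) \<open>continuous_on {x..b} z\<close>] dz' ab by auto
  have "l = v' \<xi> - u' \<xi>" "r = v' \<eta> - u' \<eta>"
    using \<xi> \<eta> dz[of \<xi>] dz[of \<eta>] ab by (auto intro: DERIV_unique)
  moreover have "(x - a) * l < 0" "(b - x) * r > 0"
    using \<xi>(4) \<eta>(4) bdry neg unfolding z_def by linarith+
  then have "l < 0" "r > 0" using ab by (auto simp: mult_less_0_iff zero_less_mult_iff)
  ultimately have "phi p (v' \<xi>) < phi p (u' \<xi>)" "phi p (u' \<eta>) < phi p (v' \<eta>)"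
    using \<open>1 < p\<close> by (auto intro: phi_strict_mono)
  then show False using anti[of \<xi> \<eta>] \<xi> \<eta> by linarith
qed

lemma
  assumes "C1_closed a b v"
  shows C1_closed_has_derivative: "x \<in> {a<..<b} \<Longrightarrow> (v has_real_derivative deriv_on a b v x) (at x)"
    and C1_closed_continuous_on: "continuous_on {a..b} v"
    and C1_closed_continuous_on_deriv: "continuous_on {a..b} (deriv_on a b v)"
proof -
  have diff: "v differentiable_on {a..b}" using assms by (simp add: C1_closed_def)
  then show "continuous_on {a..b} v" by (rule differentiable_imp_continuous_on)
  show "continuous_on {a..b} (deriv_on a b v)" using assms by (simp add: C1_closed_def)
  assume x: "x \<in> {a<..<b}"
  then have "v differentiable (at x within {a..b})"
    using diff by (auto simp: differentiable_on_def)
  then have "(v has_vector_derivative deriv_on a b v x) (at x within {a..b})"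
    unfolding deriv_on_def by (simp add: vector_derivative_works)
  then show "(v has_real_derivative deriv_on a b v x) (at x)"
    using x by (simp add: has_real_derivative_iff_has_vector_derivative at_within_Icc_at)
qed

text \<open>The difference of the two fluxes is absolutely continuous with derivative 0 almost
  everywhere, hence constant, so comparison applies in both directions.\<close>

lemma p_dirichlet_solution_unique:
  assumes "1 < p" and v: "p_dirichlet_solution a b p h v" and u: "p_dirichlet_solution a b p h u"
    and x: "x \<in> {a..b}"
  shows "u x = v x"
proof -
  define D where "D = (\<lambda>x. phi p (deriv_on a b v x) - phi p (deriv_on a b u x))"
  have "AE x in lebesgue_on {a<..<b}. ((\<lambda>y. phi p (deriv_on a b v y)) has_real_derivative - h x) (at x)"
    "AE x in lebesgue_on {a<..<b}. ((\<lambda>y. phi p (deriv_on a b u y)) has_real_derivative - h x) (at x)"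
    using v u by (simp_all add: p_dirichlet_solution_def)
  then have ae: "AE x in lebesgue_on {a<..<b}. (D has_real_derivative 0) (at x)"
  proof eventually_elim
    case (elim x)
    then show ?case using DERIV_diff[OF elim] by (simp add: D_def)
  qed
  then obtain N where N: "N \<in> null_sets (lebesgue_on {a<..<b})"
      "{x \<in> space (lebesgue_on {a<..<b}). \<not> (D has_real_derivative 0) (at x)} \<subseteq> N"
    unfolding eventually_ae_filter by auto
  then have "negligible N"
    by (simp add: negligible_iff_null_sets null_sets_restrict_space)
  have ac: "abs_continuous_on a b D"
    using v u unfolding p_dirichlet_solution_def D_def by (intro abs_continuous_on_diff) auto
  have const: "D y = D a" if "a \<le> y" "y \<le> b" for y
    using that N(2)
    by (intro abs_continuous_zero_derivative_imp_eq[OF _ abs_continuous_on_subinterval[OF ac] \<open>negligible N\<close>]) auto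
  have C1: "C1_closed a b v" "C1_closed a b u" "v a = 0" "u a = 0" "v b = 0" "u b = 0"
    using v u by (auto simp: p_dirichlet_solution_def)
  note dv = C1_closed_has_derivative[OF C1(1)] and du = C1_closed_has_derivative[OF C1(2)]
    and cv = C1_closed_continuous_on[OF C1(1)] and cu = C1_closed_continuous_on[OF C1(2)]
  have bdry: "v a = u a" "v b = u b" using C1 by auto
  have D: "D y = D x" if "a < x" "x \<le> y" "y < b" for x y
    using const[of x] const[of y] that by simp
  show ?thesis
  proof (rule antisym)
    show "u x \<le> v x"
    proof (rule phi_comparison[OF \<open>1 < p\<close> cv cu dv du bdry _ x])
      fix s t assume "a < s" "s \<le> t" "t < b"
      then show "phi p (deriv_on a b v t) - phi p (deriv_on a b u t)
          \<le> phi p (deriv_on a b v s) - phi p (deriv_on a b u s)"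
        using D[of s t] by (simp add: D_def)
    qed
    show "v x \<le> u x"
    proof (rule phi_comparison[OF \<open>1 < p\<close> cu cv du dv bdry[symmetric] _ x])
      fix s t assume "a < s" "s \<le> t" "t < b"
      then show "phi p (deriv_on a b u t) - phi p (deriv_on a b v t)
          \<le> phi p (deriv_on a b u s) - phi p (deriv_on a b v s)"
        using D[of s t] by (simp add: D_def)
    qed
  qed
qed

section \<open>Existence by shooting\<close>

text \<open>Integrating the equation forces the flux to be c - M, where M is the primitive of
  \<open>m\<close>. Inverting \<open>phi\<close> and integrating again gives v, and c is tuned to
  meet the condition at b. The explicit flux is part of the conclusion because the positivity
  argument compares it with \<open>K\<close>.\<close>

lemma p_dirichlet_solution_exists:
  fixes m :: "real \<Rightarrow> real"
  assumes "a < b" "1 < p" and m: "m absolutely_integrable_on {a..b}"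
  obtains v c where "p_dirichlet_solution a b p m v" "\<And>x. x \<notin> {a..b} \<Longrightarrow> v x = 0"
    "\<And>x. x \<in> {a..b} \<Longrightarrow> phi p (deriv_on a b v x) = c - integral {a..x} m"
proof -
  define M where "M = (\<lambda>x. integral {a..x} m)"
  define q where "q = p / (p - 1)"
  have "q > 1" using \<open>1 < p\<close> by (simp add: q_def field_simps)
  have mint: "m integrable_on {a..b}" using m by (rule set_lebesgue_integral_eq_integral)
  have cM: "continuous_on {a..b} M"
    unfolding M_def by (rule indefinite_integral_continuous_1[OF mint])
  \<comment> \<open>The value at b of the candidate whose flux is c - M, as a function of the
    shooting parameter c.\<close>
  define I where "I = (\<lambda>c. integral (cbox a b) (\<lambda>t. phi q (c - M t)))"
  have ch: "continuous_on {a..b} (\<lambda>t. phi q (c - M t))" for c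
    by (intro continuous_on_compose2[OF continuous_on_phi[OF \<open>q > 1\<close>, of UNIV]] continuous_intros cM) auto
  have cI: "continuous_on S I" for S
    unfolding I_def
  proof (rule integral_continuous_on_param)
    have "continuous_on (S \<times> cbox a b) (\<lambda>z. phi q (fst z - M (snd z)))"
      by (intro continuous_on_compose2[OF continuous_on_phi[OF \<open>q > 1\<close>, of UNIV]] continuous_intros
          continuous_on_compose2[OF cM]) auto
    then show "continuous_on (S \<times> cbox a b) (\<lambda>(c, t). phi q (c - M t))"
      by (simp add: case_prod_unfold)
  qed
  obtain t1 where t1: "t1 \<in> {a..b}" "\<And>t. t \<in> {a..b} \<Longrightarrow> M t1 \<le> M t"
    using continuous_attains_inf[OF _ _ cM] \<open>a < b\<close> by auto
  obtain t2 where t2: "t2 \<in> {a..b}" "\<And>t. t \<in> {a..b} \<Longrightarrow> M t \<le> M t2"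
    using continuous_attains_sup[OF _ _ cM] \<open>a < b\<close> by auto
  have phi0: "phi q 0 = 0" by (simp add: phi_def)
  have mono: "phi q s \<le> phi q t" if "s \<le> t" for s t
    using phi_strict_mono[OF \<open>q > 1\<close>, of s t] that by (cases "s = t") auto
  \<comment> \<open>For c equal to the minimum of \<open>M\<close> the integrand is nonpositive, for
    the maximum it is nonnegative; the intermediate value theorem supplies a zero of
    \<open>I\<close>.\<close>
  have "I (M t1) \<le> integral (cbox a b) (\<lambda>t. 0)"
    unfolding I_def using ch mono[of _ 0] t1(2)
    by (intro integral_le) (auto simp: phi0 intro: integrable_continuous_interval)
  moreover have "integral (cbox a b) (\<lambda>t. 0) \<le> I (M t2)"
    unfolding I_def using ch mono[of 0] t2(2)
    by (intro integral_le) (auto simp: phi0 intro: integrable_continuous_interval)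
  ultimately obtain c where c: "I c = 0"
    using IVT'[of I "M t1" 0 "M t2"] t1(2)[OF t2(1)] cI by auto
  define h where "h = (\<lambda>t. phi q (c - M t))"
  define v where "v = (\<lambda>x. if x \<in> {a..b} then integral {a..x} h else 0)"
  have v': "(v has_vector_derivative h x) (at x within {a..b})" if "x \<in> {a..b}" for x
  proof -
    have "((\<lambda>x. integral {a..x} h) has_vector_derivative h x) (at x within {a..b})"
      using ch that unfolding h_def by (intro integral_has_vector_derivative) auto
    then show ?thesis
      by (rule has_vector_derivative_transform[rotated 2]) (use that in \<open>auto simp: v_def\<close>)
  qed
  have dv: "deriv_on a b v x = h x" if "x \<in> {a..b}" for x
    unfolding deriv_on_def using \<open>a < b\<close> that v'
    by (intro vector_derivative_within_cbox[where a=a and b=b, simplified]) auto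
  have w: "phi p (deriv_on a b v x) = c - M x" if "x \<in> {a..b}" for x
    using dv[OF that] phi_conjugate[OF \<open>1 < p\<close>] by (simp add: h_def q_def)
  have C1: "C1_closed a b v"
    unfolding C1_closed_def
  proof
    show "v differentiable_on {a..b}"
      using v' unfolding differentiable_on_def by (blast intro: differentiableI_vector)
    show "continuous_on {a..b} (deriv_on a b v)"
      by (rule continuous_on_eq[OF ch[of c]]) (simp add: dv h_def)
  qed
  have ac: "abs_continuous_on a b (\<lambda>x. phi p (deriv_on a b v x))"
    by (rule abs_continuous_on_cong[OF abs_continuous_on_diff[OF abs_continuous_on_const
        abs_continuous_on_indefinite_integral[OF m]], of c]) (simp add: w M_def)
  \<comment> \<open>The flux agrees with \<open>c - M\<close> on the whole interval, so the equation
    holds wherever the Lebesgue differentiation theorem gives M' = m.\<close>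
  have "AE x in lebesgue_on {a<..<b}. ((\<lambda>y. phi p (deriv_on a b v y)) has_real_derivative - m x) (at x)"
  proof (rule AE_I')
    let ?N = "{x \<in> {a<..<b}. \<not> (M has_real_derivative m x) (at x)}"
    show "?N \<in> null_sets (lebesgue_on {a<..<b})"
      using negligible_not_deriv_indefinite_integral[OF mint]
      by (auto simp: M_def negligible_iff_null_sets null_sets_restrict_space)
    have "((\<lambda>y. phi p (deriv_on a b v y)) has_real_derivative - m x) (at x)"
      if "x \<in> {a<..<b}" "(M has_real_derivative m x) (at x)" for x
    proof (rule has_field_derivative_transform_within_open[of "\<lambda>y. c - M y" _ _ "{a<..<b}"])
      show "((\<lambda>y. c - M y) has_real_derivative - m x) (at x)"
        using that by (auto intro!: derivative_eq_intros)
    qed (use that w in auto)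
    then show "{x \<in> space (lebesgue_on {a<..<b}).
        \<not> ((\<lambda>y. phi p (deriv_on a b v y)) has_real_derivative - m x) (at x)} \<subseteq> ?N"
      by auto
  qed
  moreover have "v a = 0" "v b = 0"
    using c \<open>a < b\<close> by (auto simp: v_def I_def h_def)
  ultimately have "p_dirichlet_solution a b p m v"
    using C1 ac by (simp add: p_dirichlet_solution_def)
  moreover have "v x = 0" if "x \<notin> {a..b}" for x using that by (simp only: v_def if_False)
  ultimately show ?thesis
    using that[of v c] w unfolding M_def by blast
qed

text \<open>Uniqueness determines the solution on \<open>{a..b}\<close> and the extension by 0
  determines it elsewhere, so the definite description is well defined.\<close>

lemma solution_op_eqI:
  assumes "1 < p" "p_dirichlet_solution a b p h v" "\<And>x. x \<notin> {a..b} \<Longrightarrow> v x = 0"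
  shows "solution_op a b p h = v"
  unfolding solution_op_def
proof (rule the_equality)
  fix u assume u: "p_dirichlet_solution a b p h u \<and> (\<forall>x. x \<notin> {a..b} \<longrightarrow> u x = 0)"
  show "u = v"
  proof
    fix x show "u x = v x"
      using p_dirichlet_solution_unique[OF assms(1,2), of u x] u assms(3)[of x] by (cases "x \<in> {a..b}") auto
  qed
qed (use assms in auto)

subsection \<open>The singular problem\<close>

text \<open>
  The derivative exists everywhere although \<open>w\<close> and the integral of \<open>m\<close> are differentiable only
  almost everywhere: the increments of \<open>w\<close>, weighted by \<open>F\<close>, cancel those of the integral to first order.
\<close>

lemma integrable_combination_has_derivative:
  fixes F w m :: "real \<Rightarrow> real"
  assumes x: "x \<in> {c<..<d}"
    and F: "continuous_on {c..d} F" "\<And>t. t \<in> {c..d} \<Longrightarrow> F t > 0" "(F has_real_derivative F') (at x)"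
    and w: "continuous_on {c..d} w"
    and m: "m absolutely_integrable_on {c..d}"
    and wm: "\<And>y. y \<in> {c..d} \<Longrightarrow> w y - w c = - integral {c..y} (\<lambda>t. m t / F t)"
  shows "((\<lambda>y. integral {c..y} m + F y * w y) has_real_derivative F' * w x) (at x)"
proof -
  define g where "g = (\<lambda>t. m t / F t)"
  \<comment> \<open>Since m = F g, splitting F t into (F t - F x) + F x isolates the remainder
    \<open>R\<close>; the other part integrates to an increment of \<open>w\<close>.
    \<open>A\<close> will measure how small \<open>R\<close> is near x.\<close>
  define R where "R = (\<lambda>y. integral {c..y} (\<lambda>t. (F t - F x) * g t))"
  define A where "A = (\<lambda>y. integral {c..y} (\<lambda>t. \<bar>g t\<bar>))"
  have prod: "(\<lambda>t. h t * m t) absolutely_integrable_on {c..d}" if "continuous_on {c..d} h" for h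
    using that m
    by (intro absolutely_integrable_bounded_measurable_product_real)
      (auto intro!: continuous_imp_measurable_on_sets_lebesgue compact_imp_bounded compact_continuous_image)
  have "continuous_on {c..d} (\<lambda>t. 1 / F t)" "continuous_on {c..d} (\<lambda>t. (F t - F x) / F t)"
    using F(2) by (auto intro!: continuous_intros F(1) simp: order_less_imp_not_eq2)
  from this[THEN prod] have g: "g absolutely_integrable_on {c..d}"
    and Fg: "(\<lambda>t. (F t - F x) * g t) absolutely_integrable_on {c..d}"
    by (simp_all add: g_def)
  have gint: "g integrable_on {c..d}" and agint: "(\<lambda>t. \<bar>g t\<bar>) integrable_on {c..d}"
    using g unfolding absolutely_integrable_on_def real_norm_def by blast+
  have Fgint: "(\<lambda>t. (F t - F x) * g t) integrable_on {c..d}"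
    using Fg by (rule set_lebesgue_integral_eq_integral)
  have diff: "integral {c..t} h - integral {c..s} h = integral {s..t} h"
    if "c \<le> s" "s \<le> t" "t \<le> d" "h integrable_on {c..d}" for s t and h :: "real \<Rightarrow> real"
    using Henstock_Kurzweil_Integration.integral_combine[OF that(1,2), of h]
      integrable_subinterval_real[OF that(4), of c t] that by auto
  have RA: "\<bar>R t - R s\<bar> \<le> \<kappa> * (A t - A s)"
    if st: "c \<le> s" "s \<le> t" "t \<le> d" and \<kappa>: "\<And>r. s \<le> r \<Longrightarrow> r \<le> t \<Longrightarrow> \<bar>F r - F x\<bar> \<le> \<kappa>" for s t \<kappa>
  proof -
    have "\<bar>R t - R s\<bar> = norm (integral {s..t} (\<lambda>t. (F t - F x) * g t))"
      unfolding R_def using diff[OF st Fgint] by simp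
    also have "\<dots> \<le> integral {s..t} (\<lambda>t. \<kappa> * \<bar>g t\<bar>)"
    proof (rule integral_norm_bound_integral)
      show "(\<lambda>t. (F t - F x) * g t) integrable_on {s..t}"
        using st by (intro integrable_subinterval_real[OF Fgint]) auto
      show "(\<lambda>t. \<kappa> * \<bar>g t\<bar>) integrable_on {s..t}"
        using st by (intro integrable_on_mult_right integrable_subinterval_real[OF agint]) auto
      show "norm ((F r - F x) * g r) \<le> \<kappa> * \<bar>g r\<bar>" if "r \<in> {s..t}" for r
        using \<kappa>[of r] that by (auto simp: abs_mult intro: mult_right_mono)
    qed
    also have "\<dots> = \<kappa> * (A t - A s)"
      unfolding A_def diff[OF st agint] by simp
    finally show ?thesis .
  qed
  have "continuous_on {c..d} A"
    unfolding A_def by (rule indefinite_integral_continuous_1[OF agint])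
  then have contA: "isCont A x"
    using x continuous_on_interior[of "{c..d}" A x] by simp
  have dR: "(R has_real_derivative 0) (at x)"
    unfolding has_field_derivative_def has_derivative_at_alt
  proof (intro conjI allI impI bounded_linear_mult_right)
    fix e :: real assume "e > 0"
    \<comment> \<open>A Lipschitz constant of \<open>F\<close> at x: the slope |F'| plus the
      tolerance 1 in the definition of the derivative. Thus |R y - R x| is at most C |y - x| times
      an increment of \<open>A\<close>, which is small by continuity of \<open>A\<close>.\<close>
    define C where "C = \<bar>F'\<bar> + 1"
    have "C > 0" by (simp add: C_def add_pos_pos)
    obtain d1 where d1: "d1 > 0" "\<And>y. \<bar>y - x\<bar> < d1 \<Longrightarrow> \<bar>F y - F x - F' * (y - x)\<bar> \<le> 1 * \<bar>y - x\<bar>"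
      using F(3)[unfolded has_field_derivative_def has_derivative_at_alt, THEN conjunct2, rule_format, of 1]
      by auto
    have F_lip: "\<bar>F y - F x\<bar> \<le> C * \<bar>y - x\<bar>" if "\<bar>y - x\<bar> < d1" for y
    proof -
      have "\<bar>F y - F x\<bar> \<le> \<bar>F y - F x - F' * (y - x)\<bar> + \<bar>F' * (y - x)\<bar>" by linarith
      also have "\<dots> \<le> 1 * \<bar>y - x\<bar> + \<bar>F'\<bar> * \<bar>y - x\<bar>"
        using d1(2)[OF that] by (simp add: abs_mult)
      finally show ?thesis by (simp add: C_def algebra_simps)
    qed
    have "e / C > 0" using \<open>e > 0\<close> \<open>C > 0\<close> by simp
    then obtain d2 where d2: "d2 > 0" "\<And>y. \<bar>y - x\<bar> < d2 \<Longrightarrow> \<bar>A y - A x\<bar> < e / C"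
      using contA unfolding continuous_at_eps_delta dist_real_def by blast
    show "\<exists>\<delta>>0. \<forall>y. norm (y - x) < \<delta> \<longrightarrow> norm (R y - R x - 0 * (y - x)) \<le> e * norm (y - x)"
    proof (intro exI[of _ "Min {d1, d2, x - c, d - x}"] conjI allI impI)
      fix y assume "norm (y - x) < Min {d1, d2, x - c, d - x}"
      then have y: "\<bar>y - x\<bar> < d1" "\<bar>y - x\<bar> < d2" "c < y" "y < d" by auto
      have "\<bar>R y - R x\<bar> \<le> (C * \<bar>y - x\<bar>) * \<bar>A y - A x\<bar>"
      proof (cases "x \<le> y")
        case True
        have "\<bar>F r - F x\<bar> \<le> C * \<bar>y - x\<bar>" if "x \<le> r" "r \<le> y" for r
          using F_lip[of r] that y \<open>C > 0\<close> mult_left_mono[of "\<bar>r - x\<bar>" "\<bar>y - x\<bar>" C] by linarith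
        then have "\<bar>R y - R x\<bar> \<le> (C * \<bar>y - x\<bar>) * (A y - A x)"
          using True x y by (intro RA) auto
        also have "\<dots> \<le> (C * \<bar>y - x\<bar>) * \<bar>A y - A x\<bar>"
          using \<open>C > 0\<close> by (intro mult_left_mono) auto
        finally show ?thesis .
      next
        case False
        have "\<bar>F r - F x\<bar> \<le> C * \<bar>y - x\<bar>" if "y \<le> r" "r \<le> x" for r
          using F_lip[of r] that y \<open>C > 0\<close> mult_left_mono[of "\<bar>r - x\<bar>" "\<bar>y - x\<bar>" C] by linarith
        then have "\<bar>R x - R y\<bar> \<le> (C * \<bar>y - x\<bar>) * (A x - A y)"
          using False x y by (intro RA) auto
        also have "\<dots> \<le> (C * \<bar>y - x\<bar>) * \<bar>A y - A x\<bar>"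
          using \<open>C > 0\<close> by (intro mult_left_mono) auto
        finally show ?thesis by (simp add: abs_minus_commute)
      qed
      also have "\<dots> \<le> (C * \<bar>y - x\<bar>) * (e / C)"
        using d2(2)[OF y(2)] \<open>C > 0\<close> by (intro mult_left_mono) auto
      also have "\<dots> = e * \<bar>y - x\<bar>" using \<open>C > 0\<close> by simp
      finally show "norm (R y - R x - 0 * (y - x)) \<le> e * norm (y - x)" by simp
    qed (use d1 d2 x in auto)
  qed
  have "isCont w x"
    using x w continuous_on_interior[of "{c..d}" w x] by simp
  \<comment> \<open>The factor F y - F x vanishes at x, so continuity of \<open>w\<close> is enough
    to differentiate the product there.\<close>
  then have "((\<lambda>y. (F y - F x) / (y - x) * w y) \<longlongrightarrow> F' * w x) (at x)"
    using F(3) unfolding has_field_derivative_iff isCont_def by (intro tendsto_mult) auto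
  then have dFw: "((\<lambda>y. (F y - F x) * w y) has_real_derivative F' * w x) (at x)"
    unfolding has_field_derivative_iff by simp
  have "((\<lambda>y. R y + (F y - F x) * w y + F x * w c) has_real_derivative 0 + F' * w x + 0) (at x)"
    by (intro DERIV_add dR dFw DERIV_const)
  then have "((\<lambda>y. R y + (F y - F x) * w y + F x * w c) has_real_derivative F' * w x) (at x)"
    by simp
  then show ?thesis
  proof (rule has_field_derivative_transform_within_open[of _ _ _ "{c<..<d}"])
    fix y assume y: "y \<in> {c<..<d}"
    have sub: "g integrable_on {c..y}" "(\<lambda>t. (F t - F x) * g t) integrable_on {c..y}"
      using y by (auto intro: integrable_subinterval_real[OF gint] integrable_subinterval_real[OF Fgint])
    \<comment> \<open>With the integral of \<open>g\<close> over [c, y] equal to w c - w y, the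
      terms in F x * w y recombine to (F y - F x) * w y, plus the constant F x * w c.\<close>
    have "integral {c..y} m = integral {c..y} (\<lambda>t. (F t - F x) * g t + F x * g t)"
    proof (rule Henstock_Kurzweil_Integration.integral_cong)
      fix t assume "t \<in> {c..y}"
      then show "m t = (F t - F x) * g t + F x * g t"
        using F(2)[of t] y by (simp add: g_def field_simps)
    qed
    also have "\<dots> = R y + F x * integral {c..y} g"
      unfolding R_def using sub by (subst Henstock_Kurzweil_Integration.integral_add) (auto intro: integrable_on_mult_right)
    also have "integral {c..y} g = w c - w y"
      using wm[of y] y by (simp add: g_def)
    finally show "R y + (F y - F x) * w y + F x * w c = integral {c..y} m + F y * w y"
      by (simp add: algebra_simps)
  qed (use x in auto)
qed

text \<open>On an interval of finite length the bound |t| \<le> 1 + |t|^q gives an integrable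
  majorant.\<close>

lemma in_Lq_imp_absolutely_integrable:
  assumes "in_Lq q a b m" "1 \<le> q"
  shows "m absolutely_integrable_on {a..b}"
proof -
  let ?L = "lebesgue_on {a<..<b}"
  have "integrable ?L m"
  proof (rule Bochner_Integration.integrable_bound)
    show "integrable ?L (\<lambda>x. 1 + \<bar>m x\<bar> powr q)"
      using assms finite_measure.integrable_const[OF finite_measure_lebesgue_on, of "{a<..<b}" "1::real"]
      by (intro Bochner_Integration.integrable_add) (simp_all add: in_Lq_def)
    have "\<bar>t\<bar> \<le> 1 + \<bar>t\<bar> powr q" for t :: real
    proof (cases "\<bar>t\<bar> \<le> 1")
      case False
      then have "\<bar>t\<bar> powr 1 \<le> \<bar>t\<bar> powr q" using assms by (intro powr_mono) auto
      then show ?thesis using False by simp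
    qed (simp add: add_increasing2)
    then show "AE x in ?L. norm (m x) \<le> norm (1 + \<bar>m x\<bar> powr q)" by simp
  qed (use assms in \<open>simp add: in_Lq_def\<close>)
  then have "m absolutely_integrable_on {a<..<b}"
    by (simp add: set_integrable_def integrable_restrict_space)
  then show ?thesis
    unfolding absolutely_integrable_on_def by (simp add: integrable_on_Icc_iff_Ioo)
qed

theorem theorem3p3:
  fixes a b p \<gamma> :: real and m u :: "real \<Rightarrow> real"
  assumes "a < b" and "1 < p" and "0 < \<gamma>"
    and "in_Lq (p / (p - 1)) a b m"
    and "singular_solution a b p \<gamma> m u"
    and "C1_closed a b u"
    and "abs_continuous_on a b (\<lambda>x. phi p (deriv_on a b u x))"
  shows "(\<forall>x\<in>{a<..<b}. 0 < solution_op a b p m x) \<and>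
         0 < (LINT x|lebesgue_on {a<..<b}. m x)"
proof -
  define u' where "u' = deriv_on a b u"
  define w where "w = (\<lambda>x. phi p (u' x))"
  define M where "M = (\<lambda>x. integral {a..x} m)"
  define K where "K = (\<lambda>x. M x + u x powr \<gamma> * w x)"
  have m: "m absolutely_integrable_on {a..b}"
    using assms(2) by (intro in_Lq_imp_absolutely_integrable[OF assms(4)]) (simp add: field_simps)
  then have mint: "m integrable_on {a..b}"
    by (rule set_lebesgue_integral_eq_integral)
  have u: "continuous_on {a..b} u" "u a = 0" "u b = 0" "\<And>x. x \<in> {a<..<b} \<Longrightarrow> 0 < u x"
    and weak: "\<And>\<psi>. test_function a b \<psi> \<Longrightarrow>
        (LINT x|lebesgue_on {a<..<b}. phi p (deriv u x) * deriv \<psi> x) =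
        (LINT x|lebesgue_on {a<..<b}. m x * u x powr (- \<gamma>) * \<psi> x)"
    using assms(5) by (auto simp: singular_solution_def)
  have u0: "0 \<le> u x" if "x \<in> {a..b}" for x
    using u(2,3) u(4)[of x] that by (cases "x = a \<or> x = b") (auto simp: order_less_le)
  have du: "(u has_real_derivative u' x) (at x)" if "x \<in> {a<..<b}" for x
    unfolding u'_def using that by (rule C1_closed_has_derivative[OF assms(6)])
  have cw: "continuous_on {a..b} w"
    unfolding w_def u'_def
    by (intro continuous_on_compose2[OF continuous_on_phi[OF assms(2), of UNIV]]
        C1_closed_continuous_on_deriv[OF assms(6)]) auto
  have upowr: "continuous_on {a..b} (\<lambda>x. u x powr s)" if "s > 0" for s
    using u0 that by (intro continuous_on_powr' u(1) continuous_on_const) auto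
  have w_diff: "w y - w x = - integral {x..y} (\<lambda>t. m t * u t powr (- \<gamma>))" if "a < x" "x < y" "y < b" for x y
  proof (rule weak_derivative_eq_integral[OF cw _ _ that])
    fix x y assume xy: "a < x" "y < b"
    have c: "continuous_on {x..y} (\<lambda>t. u t powr (- \<gamma>))"
      using xy u(4) by (intro continuous_on_powr continuous_on_const continuous_on_subset[OF u(1)])
        (auto simp: order_less_imp_not_eq2)
    have "m absolutely_integrable_on {x..y}"
      using m by (rule set_integrable_subset) (use xy in auto)
    then have "(\<lambda>t. u t powr (- \<gamma>) * m t) absolutely_integrable_on {x..y}"
      using c by (intro absolutely_integrable_bounded_measurable_product_real)
        (auto intro!: continuous_imp_measurable_on_sets_lebesgue compact_imp_bounded compact_continuous_image)
    then show "(\<lambda>t. m t * u t powr (- \<gamma>)) absolutely_integrable_on {x..y}"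
      by (simp add: mult.commute)
  next
    fix \<psi> assume "test_function a b \<psi>"
    from weak[OF this]
    have "(LINT x|lebesgue_on {a<..<b}. m x * u x powr - \<gamma> * \<psi> x) =
        (LINT x|lebesgue_on {a<..<b}. phi p (deriv u x) * deriv \<psi> x)" by simp
    also have "\<dots> = (LINT x|lebesgue_on {a<..<b}. w x * deriv \<psi> x)"
      using DERIV_imp_deriv[OF du] by (intro Bochner_Integration.integral_cong) (auto simp: w_def)
    finally show "(LINT x|lebesgue_on {a<..<b}. w x * deriv \<psi> x) =
        (LINT x|lebesgue_on {a<..<b}. m x * u x powr - \<gamma> * \<psi> x)" by simp
  qed
  have dK: "(K has_real_derivative \<gamma> * u x powr (\<gamma> - 1) * u' x * w x) (at x)" if x: "x \<in> {a<..<b}" for x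
  proof -
    \<comment> \<open>A compact neighbourhood of x inside (a, b); \<open>u\<close> is positive on
      it, so the general lemma applies with F = \<open>u powr \<gamma>\<close>.\<close>
    define c d where "c = (a + x) / 2" and "d = (x + b) / 2"
    have cd: "a < c" "c < x" "x < d" "d < b" using x by (auto simp: c_def d_def)
    have "((\<lambda>y. integral {c..y} m + u y powr \<gamma> * w y) has_real_derivative (\<gamma> * u x powr (\<gamma> - 1) * u' x) * w x) (at x)"
    proof (rule integrable_combination_has_derivative[where d = d])
      show "((\<lambda>x. u x powr \<gamma>) has_real_derivative \<gamma> * u x powr (\<gamma> - 1) * u' x) (at x)"
        using DERIV_fun_powr[OF du[OF x] u(4)[OF x], of \<gamma>] by simp
      show "continuous_on {c..d} (\<lambda>x. u x powr \<gamma>)" "continuous_on {c..d} w"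
        using cd assms(3) by (auto intro: continuous_on_subset[OF upowr] continuous_on_subset[OF cw])
      show "m absolutely_integrable_on {c..d}"
        using m by (rule set_integrable_subset) (use cd in auto)
      show "u t powr \<gamma> > 0" if "t \<in> {c..d}" for t using u(4)[of t] cd that by auto
      show "w y - w c = - integral {c..y} (\<lambda>t. m t / u t powr \<gamma>)" if "y \<in> {c..d}" for y
        using w_diff[of c y] cd that by (cases "y = c") (auto simp: powr_minus divide_inverse)
    qed (use cd in auto)
    \<comment> \<open>The constant \<open>M c\<close> moves the base point of the integral from c
      back to a.\<close>
    then have "((\<lambda>y. M c + (integral {c..y} m + u y powr \<gamma> * w y)) has_real_derivative
        0 + (\<gamma> * u x powr (\<gamma> - 1) * u' x) * w x) (at x)"
      by (intro DERIV_add DERIV_const)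
    then have "(K has_real_derivative 0 + (\<gamma> * u x powr (\<gamma> - 1) * u' x) * w x) (at x)"
    proof (rule has_field_derivative_transform_within_open[of _ _ _ "{c<..<d}"])
      fix y assume "y \<in> {c<..<d}"
      then show "M c + (integral {c..y} m + u y powr \<gamma> * w y) = K y"
        using Henstock_Kurzweil_Integration.integral_combine[of a c y m] cd
          integrable_subinterval_real[OF mint, of a y] by (auto simp: K_def M_def)
    qed (use cd in auto)
    then show ?thesis by simp
  qed
  \<comment> \<open>Here \<gamma> > 0 gives continuity of \<open>u powr \<gamma>\<close> up to the
    endpoints, where it vanishes, so the monotonicity of \<open>K\<close> extends to [a, b].\<close>
  have cK: "continuous_on {a..b} K"
    unfolding K_def M_def using assms(3)
    by (intro continuous_intros indefinite_integral_continuous_1[OF mint] upowr cw)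
  \<comment> \<open>The product of \<open>u'\<close> and \<open>w\<close> is |u'|^p.\<close>
  have dK0: "0 \<le> \<gamma> * u x powr (\<gamma> - 1) * u' x * w x" for x
    using phi_mult_self(1)[of p "u' x"] assms(3) unfolding w_def
    by (simp add: mult.assoc mult.commute[of "phi p _"])
  have K_mono: "K x \<le> K y" if "a \<le> x" "x \<le> y" "y \<le> b" for x y
  proof (rule DERIV_nonneg_imp_increasing_open[OF that(2)])
    show "\<exists>l. DERIV K t :> l \<and> 0 \<le> l" if "x < t" "t < y" for t
      using dK[of t] dK0 that \<open>a \<le> x\<close> \<open>y \<le> b\<close> by fastforce
    show "continuous_on {x..y} K"
      using that by (intro continuous_on_subset[OF cK]) auto
  qed
  have Ka: "K a = 0" and Kb: "K b = integral {a..b} m"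
    using u(2,3) by (simp_all add: K_def M_def)
  have "0 < integral {a..b} m"
  proof (rule ccontr)
    assume "\<not> 0 < integral {a..b} m"
    \<comment> \<open>A nondecreasing \<open>K\<close> with K a = 0 and K b \<le> 0 vanishes
      identically. Then u' = 0 throughout, which contradicts u a = 0 < u in the interior.\<close>
    then have K0: "K x = 0" if "x \<in> {a..b}" for x
      using K_mono[of a x] K_mono[of x b] Ka Kb that by auto
    have "(u has_real_derivative 0) (at x)" if x: "x \<in> {a<..<b}" for x
    proof -
      have "(K has_real_derivative 0) (at x)"
        by (rule has_field_derivative_transform_within_open[of "\<lambda>_. 0" _ _ "{a<..<b}"])
          (use x K0 in auto)
      then have "\<gamma> * u x powr (\<gamma> - 1) * u' x * w x = 0"
        using DERIV_unique[OF dK[OF x]] by blast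
      then have "phi p (u' x) * u' x = 0"
        using assms(3) u(4)[OF x] by (auto simp: w_def)
      then have "u' x = 0" by (simp only: phi_mult_self(2))
      then show ?thesis using du[OF x] by simp
    qed
    then have "u ((a + b) / 2) = u a"
      using assms(1) by (intro DERIV_isconst2[OF assms(1) u(1)]) auto
    then show False using u(2) u(4)[of "(a + b) / 2"] assms(1) by auto
  qed
  moreover have "(LINT x|lebesgue_on {a<..<b}. m x) = integral {a..b} m"
  proof -
    have "m absolutely_integrable_on {a<..<b}"
      using m by (rule set_integrable_subset) auto
    then have "(LINT x|lebesgue_on {a<..<b}. m x) = integral {a<..<b} m"
      by (intro lebesgue_integral_eq_integral absolutely_integrable_imp_integrable) auto
    then show ?thesis by (simp add: integral_open_interval_real)
  qed
  moreover have "0 < solution_op a b p m x" if x: "x \<in> {a<..<b}" for x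
  proof -
    obtain v c where v: "p_dirichlet_solution a b p m v" "\<And>x. x \<notin> {a..b} \<Longrightarrow> v x = 0"
      and wv: "\<And>x. x \<in> {a..b} \<Longrightarrow> phi p (deriv_on a b v x) = c - M x"
      using p_dirichlet_solution_exists[OF assms(1,2) m] unfolding M_def by blast
    have C1v: "C1_closed a b v" and bv: "v a = 0" "v b = 0"
      using v(1) by (auto simp: p_dirichlet_solution_def)
    \<comment> \<open>Chosen so that (u^k)^(p - 1) = u^\<gamma>: by homogeneity of
      \<open>phi\<close>, the function \<open>U\<close> with derivative u^k u' has flux u^\<gamma>
      \<open>w\<close>, the second term of \<open>K\<close>.\<close>
    define k where "k = \<gamma> / (p - 1)"
    have k: "k > 0" "k * (p - 1) = \<gamma>" using assms(2,3) by (auto simp: k_def)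
    define U where "U = (\<lambda>x. u x powr (1 + k) / (1 + k))"
    have dU: "(U has_real_derivative u x powr k * u' x) (at x)" if x: "x \<in> {a<..<b}" for x
      using DERIV_cdivide[OF DERIV_fun_powr[OF du[OF x] u(4)[OF x], of "1 + k"], of "1 + k"] k
      unfolding U_def by simp
    have phiU: "phi p (u y powr k * u' y) = u y powr \<gamma> * w y" if "y \<in> {a<..<b}" for y
      using phi_mult[of "u y powr k" p "u' y"] u(4)[OF that] k by (simp add: powr_powr w_def)
    \<comment> \<open>The difference of the fluxes of \<open>v\<close> and \<open>U\<close> is c -
      \<open>K\<close>, so the monotonicity of \<open>K\<close> is exactly the hypothesis of the
      comparison.\<close>
    have "U x \<le> v x"
    proof (rule phi_comparison[OF assms(2) C1_closed_continuous_on[OF C1v] _ C1_closed_has_derivative[OF C1v] dU])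
      show "continuous_on {a..b} U"
        unfolding U_def using k by (intro continuous_on_divide upowr continuous_on_const) auto
      show "v a = U a" "v b = U b" using bv u by (auto simp: U_def)
      show "x \<in> {a..b}" using x by simp
      fix s t assume st: "a < s" "s \<le> t" "t < b"
      then show "phi p (deriv_on a b v t) - phi p (u t powr k * u' t)
          \<le> phi p (deriv_on a b v s) - phi p (u s powr k * u' s)"
        using K_mono[of s t] by (simp add: phiU wv K_def)
    qed auto
    moreover have "0 < U x" using u(4)[OF x] k by (simp add: U_def)
    ultimately show ?thesis
      using solution_op_eqI[OF assms(2) v] by simp
  qed
  ultimately show ?thesis by simp
qed

end
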